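(* Let $\lambda/\mu$ be a skew partition, let $d$ and $N$ be positive integers with $d\mid N$, and let $\omega_d$ be a primitive $d$th root of unity. Then $s_{\lambda/\mu}(1,\omega_d,\ldots,\omega_d^{N-1})$ is zero unless the $d$-quotient of $\lambda/\mu$ exists, in which case $$s_{\lambda/\mu}(1,\omega_d,\ldots,\omega_d^{N-1})=\mathrm{sgn}\left(\chi^{\lambda/\mu}((d^m))\right)\prod_{i=0}^{d-1}s_{\lambda^{(i)}/\mu^{(i)}}(\underbrace{1,1,\ldots,1}_{N/d}),$$ where $|\lambda/\mu|=dm$ and the $d$-quotient of $\lambda/\mu$ is $(\lambda^{(0)}/\mu^{(0)},\ldots,\lambda^{(d-1)}/\mu^{(d-1)})$.
   Context: A skew partition $\lambda/\mu$ is a pair of partitions with $\lambda_i\ge\mu_i$ for all $i$; $|\lambda/\mu|=\sum_i(\lambda_i-\mu_i)$; $s_{\lambda/\mu}$ denotes the skew Schur polynomial (or symmetric function). Skew characters: for $\lambda/\mu$ of size $n$, the integers $\chi^{\lambda/\mu}(\nu)$ ($\nu$ a partition of $n$) are defined by $s_{\lambda/\mu}=\sum_{\nu\vdash n}\chi^{\lambda/\mu}(\nu)\,p_\nu/z_\nu$, where $p_\nu$ is the power-sum symmetric function, $z_\nu=\prod_j m_j!\,j^{m_j}$, and $m_j$ is the number of parts of $\nu$ equal to $j$. $(d^m)$ is the partition with $m$ parts equal to $d$. For a nonzero integer, $\mathrm{sgn}$ denotes its sign $\pm1$; when the $d$-quotient of $\lambda/\mu$ exists, $\chi^{\lambda/\mu}((d^m))\neq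 0$. $d$-quotient: let $r=\ell(\lambda)$ be the number of positive parts of $\lambda$. Consider $d$ vertical runners numbered $0,1,\ldots,d-1$ from left to right, with positions $0,1,2,\ldots$ marked from left to right along successive rows (so position $p$ lies on runner $p \bmod d$, in row $\lfloor p/d\rfloor$, rows going downward). For $\kappa\in\{\lambda,\mu\}$ (padded with zeros to length $r$), the $d$-abacus of $\kappa$ has a bead at each position $\kappa_i+r-i$, $1\le i\le r$, and the other positions are non-beads. For $0\le i\le d-1$, $\kappa^{(i)}$ is the partition whose $j$th part is the number of non-beads above the $j$th bead from the bottom on runner $i$. The same $r=\ell(\lambda)$ is used for $\lambda$ and $\mu$. The $d$-quotient of $\lambda/\mu$ exists if $\lambda$ and $\mu$ have the same $d$-core (equivalently, for every $i$ the abaci of $\lambda$ and $\mu$ have the same number of beads on runner $i$) and the diagram of $\lambda^{(i)}$ contains that of $\mu^{(i)}$ for all $0\le i\le d-1$; it is then the sequence $(\lambda^{(0)}/\mu^{(0)},\ldots,\lambda^{(d-1)}/\mu^{(d-1)})$. Here the $d$-core of a partition is the partition obtained by removing border strips (connected skew shapes without $2\times2$ squares) of size $d$ as many times as possible. *)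

theory Defs
  imports Complex_Main "HOL-Library.FuncSet"
begin

section \<open>Partitions and skew partitions\<close>

text \<open>A partition is the list of its positive parts in weakly decreasing order. Rows, columns
  and parts are indexed from 0.\<close>

definition is_partition :: "nat list \<Rightarrow> bool" where
  "is_partition \<kappa> \<longleftrightarrow> sorted_wrt (\<ge>) \<kappa> \<and> 0 \<notin> set \<kappa>"

definition part :: "nat list \<Rightarrow> nat \<Rightarrow> nat" where
  "part \<kappa> i = (if i < length \<kappa> then \<kappa> ! i else 0)"

definition partitions_of :: "nat \<Rightarrow> nat list set" where
  "partitions_of n = {\<nu>. is_partition \<nu> \<and> sum_list \<nu> = n}"

definition skew_partition :: "nat list \<Rightarrow> nat list \<Rightarrow> bool" where
  "skew_partition lam mu \<longleftrightarrow> is_partition lam \<and> is_partition mu \<and> (\<forall>i. part mu i \<le> part lam i)"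

definition skew_size :: "nat list \<Rightarrow> nat list \<Rightarrow> nat" where
  "skew_size lam mu = (\<Sum>i<length lam. part lam i - part mu i)"

definition skew_diagram :: "nat list \<Rightarrow> nat list \<Rightarrow> (nat \<times> nat) set" where
  "skew_diagram lam mu = {(i, j). part mu i \<le> j \<and> j < part lam i}"

section \<open>Skew Schur polynomials, power sums and skew characters\<close>

text \<open>Semistandard tableaux with entries in \<open>{0..<N}\<close>.\<close>

definition ssyt :: "nat list \<Rightarrow> nat list \<Rightarrow> nat \<Rightarrow> (nat \<times> nat \<Rightarrow> nat) set" where
  "ssyt lam mu N = {T \<in> skew_diagram lam mu \<rightarrow>\<^sub>E {..<N}.
     (\<forall>i j j'. (i, j) \<in> skew_diagram lam mu \<longrightarrow> (i, j') \<in> skew_diagram lam mu \<longrightarrow> j < j' \<longrightarrow>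
        T (i, j) \<le> T (i, j')) \<and>
     (\<forall>i i' j. (i, j) \<in> skew_diagram lam mu \<longrightarrow> (i', j) \<in> skew_diagram lam mu \<longrightarrow> i < i' \<longrightarrow>
        T (i, j) < T (i', j))}"

text \<open>The skew Schur polynomial in \<open>length xs\<close> variables, evaluated at \<open>xs\<close>.\<close>

definition skew_schur :: "nat list \<Rightarrow> nat list \<Rightarrow> 'a::comm_semiring_1 list \<Rightarrow> 'a" where
  "skew_schur lam mu xs =
     (\<Sum>T\<in>ssyt lam mu (length xs). \<Prod>c\<in>skew_diagram lam mu. xs ! T c)"

definition power_sum :: "nat list \<Rightarrow> 'a::comm_semiring_1 list \<Rightarrow> 'a" where
  "power_sum \<nu> xs = (\<Prod>k\<leftarrow>\<nu>. \<Sum>x\<leftarrow>xs. x ^ k)"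

definition z_num :: "nat list \<Rightarrow> nat" where
  "z_num \<nu> = (\<Prod>j\<in>set \<nu>. fact (count_list \<nu> j) * j ^ count_list \<nu> j)"

text \<open>An identity of symmetric functions over \<open>\<complex>\<close> is the same as the identity of the corresponding
  polynomial functions on \<open>\<complex>\<^sup>N\<close> for all \<open>N\<close>, so the power-sum expansion of \<open>s\<^bsub>lam/mu\<^esub>\<close> is
  required at every finite list of complex numbers. The coefficient function is normalised to
  vanish outside the partitions of \<open>\<bar>lam/mu\<bar>\<close>, so as to be determined by the expansion.\<close>

definition skew_char :: "nat list \<Rightarrow> nat list \<Rightarrow> nat list \<Rightarrow> int" where
  "skew_char lam mu = (THE \<chi>.
     (\<forall>\<nu>. \<nu> \<notin> partitions_of (skew_size lam mu) \<longrightarrow> \<chi> \<nu> = 0) \<and>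
     (\<forall>xs :: complex list. skew_schur lam mu xs =
        (\<Sum>\<nu>\<in>partitions_of (skew_size lam mu). of_int (\<chi> \<nu>) * power_sum \<nu> xs / of_nat (z_num \<nu>))))"

section \<open>Border strips and cores\<close>

definition adjacent_in :: "(nat \<times> nat) set \<Rightarrow> nat \<times> nat \<Rightarrow> nat \<times> nat \<Rightarrow> bool" where
  "adjacent_in D a b \<longleftrightarrow> a \<in> D \<and> b \<in> D \<and>
     (case (a, b) of ((i, j), (i', j')) \<Rightarrow>
        (i = i' \<and> (j' = Suc j \<or> j = Suc j')) \<or> (j = j' \<and> (i' = Suc i \<or> i = Suc i')))"

definition border_strip :: "nat list \<Rightarrow> nat list \<Rightarrow> bool" where
  "border_strip lam mu \<longleftrightarrow> skew_partition lam mu \<and> skew_diagram lam mu \<noteq> {} \<and>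
     (\<forall>a\<in>skew_diagram lam mu. \<forall>b\<in>skew_diagram lam mu. (adjacent_in (skew_diagram lam mu))\<^sup>*\<^sup>* a b) \<and>
     \<not> (\<exists>i j. {(i, j), (i, Suc j), (Suc i, j), (Suc i, Suc j)} \<subseteq> skew_diagram lam mu)"

definition remove_strip :: "nat \<Rightarrow> nat list \<Rightarrow> nat list \<Rightarrow> bool" where
  "remove_strip d lam \<kappa> \<longleftrightarrow> border_strip lam \<kappa> \<and> skew_size lam \<kappa> = d"

definition d_core :: "nat \<Rightarrow> nat list \<Rightarrow> nat list" where
  "d_core d lam = (THE \<kappa>. (remove_strip d)\<^sup>*\<^sup>* lam \<kappa> \<and> \<not> (\<exists>\<kappa>'. remove_strip d \<kappa> \<kappa>'))"

section \<open>Abaci and quotients\<close>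

text \<open>With rows indexed from 0, the bead of row \<open>i\<close> is at position \<open>\<kappa>\<^sub>i + r - (i + 1)\<close>.\<close>

definition beads :: "nat \<Rightarrow> nat list \<Rightarrow> nat set" where
  "beads r \<kappa> = {part \<kappa> i + (r - Suc i) | i. i < r}"

text \<open>Row \<open>q\<close> of runner \<open>i\<close> is position \<open>d * q + i\<close>. The bottom bead has the largest row number;
  beads with no non-bead above them contribute zero parts, which are dropped.\<close>

definition runner_rows :: "nat \<Rightarrow> nat \<Rightarrow> nat list \<Rightarrow> nat \<Rightarrow> nat set" where
  "runner_rows d r \<kappa> i = {q. d * q + i \<in> beads r \<kappa>}"

definition runner_partition :: "nat \<Rightarrow> nat \<Rightarrow> nat list \<Rightarrow> nat \<Rightarrow> nat list" where
  "runner_partition d r \<kappa> i =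
     filter (\<lambda>k. k \<noteq> 0)
       (map (\<lambda>q. card {q'. q' < q \<and> q' \<notin> runner_rows d r \<kappa> i})
          (rev (sorted_list_of_set (runner_rows d r \<kappa> i))))"

text \<open>The quotient is the list of pairs \<open>(lam\<^sup>(\<^sup>i\<^sup>), mu\<^sup>(\<^sup>i\<^sup>))\<close>, \<open>0 \<le> i < d\<close>, both computed
  from abaci with \<open>r = \<ell>(lam)\<close> beads.\<close>

definition d_quotient :: "nat \<Rightarrow> nat list \<Rightarrow> nat list \<Rightarrow> (nat list \<times> nat list) list" where
  "d_quotient d lam mu =
     map (\<lambda>i. (runner_partition d (length lam) lam i, runner_partition d (length lam) mu i)) [0..<d]"

definition d_quotient_exists :: "nat \<Rightarrow> nat list \<Rightarrow> nat list \<Rightarrow> bool" where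
  "d_quotient_exists d lam mu \<longleftrightarrow> d_core d lam = d_core d mu \<and>
     (\<forall>(\<alpha>, \<beta>)\<in>set (d_quotient d lam mu). skew_partition \<alpha> \<beta>)"

section \<open>Roots of unity\<close>

definition primitive_root_of_unity :: "nat \<Rightarrow> complex \<Rightarrow> bool" where
  "primitive_root_of_unity d \<omega> \<longleftrightarrow> \<omega> ^ d = 1 \<and> (\<forall>k. 0 < k \<and> k < d \<longrightarrow> \<omega> ^ k \<noteq> 1)"

end

theory Submission
  imports Defs "HOL-Library.Multiset" "HOL-Computational_Algebra.Formal_Power_Series"
    "Jordan_Normal_Form.Determinant"
begin

text \<open>Let \<open>h\<^sub>k\<close> be the complete homogeneous symmetric polynomials. By the Jacobi-Trudi identity
(lemma \<open>jacobi_trudi\<close>) the skew Schur polynomial is the determinant of the numbers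
\<open>h\<^bsub>a - b\<^esub>\<close>, where \<open>a\<close> runs over the beads of \<open>lam\<close> and \<open>b\<close> over the beads of \<open>mu\<close>.

At the variables \<open>1, \<omega>, \<dots>, \<omega>\<^bsup>d M - 1\<^esup>\<close> the power sum \<open>p\<^sub>k\<close> is \<open>d M\<close> or \<open>0\<close>, according to whether
\<open>d\<close> divides \<open>k\<close>, so Newton's identities give \<open>h\<^sub>k = 0\<close> for \<open>k\<close> not divisible by \<open>d\<close>, and
\<open>h\<^bsub>d k\<^esub>\<close> becomes the value of \<open>h\<^sub>k\<close> at \<open>M\<close> ones (\<open>hsym_roots_of_unity\<close>). Hence only beads on the
same runner interact. If some runner carries different numbers of beads of \<open>lam\<close> and \<open>mu\<close>, every
term of the determinant vanishes. Otherwise sorting the beads by runners makes the matrix block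
diagonal, and each block is again a Jacobi-Trudi matrix, namely that of a component of the
quotient at \<open>M\<close> ones. Thus the value is \<open>\<epsilon>\<close> times the product of the components' values, where
\<open>\<epsilon> = \<plusminus>1\<close> is the sign of the sorting permutations (\<open>skew_schur_roots_balanced\<close>). What matters
below is that \<open>\<epsilon>\<close> does not depend on \<open>M\<close>. A component whose inner partition is not contained in the
outer one contributes \<open>0\<close>. That equality of cores means equality of the bead counts on all runners is
\<open>d_core_eq_iff\<close>: removing a border strip of size \<open>d\<close> is moving a bead one row up on its runner.

The sign \<open>\<epsilon>\<close> is identified by letting \<open>M\<close> grow. Expanded in power sums, the left side is a polynomial
in \<open>M\<close> of degree at most \<open>m\<close>, because only the \<open>\<nu>\<close> with all parts divisible by \<open>d\<close> survive, and
its coefficient at \<open>M\<^sup>m\<close> is \<open>\<chi>\<close> at \<open>(d\<^sup>m)\<close> divided by \<open>m!\<close>. The right side is \<open>\<epsilon>\<close> times a number of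
tuples of tableaux that grows at least like a positive multiple of \<open>M\<^sup>m\<close>. So \<open>\<epsilon>\<close> is the sign of the
character value (\<open>sgn_top_coefficient\<close>).

For this the character, defined as the unique integral coefficient function of the power sum
expansion, must exist and be unique. Existence: the class of functions with an integral expansion
contains every \<open>h\<^sub>n = \<Sum>\<^sub>\<nu> p\<^sub>\<nu> / z\<^sub>\<nu>\<close> and is closed under sums and products, so it contains the
Jacobi-Trudi determinant (\<open>int_char_expansion_jacobi_trudi\<close>). Uniqueness is the linear independence
of the products of power sums (\<open>power_sums_independent\<close>).\<close>

section \<open>Tableaux and removal of the largest entry\<close>

text \<open>Tableaux are considered on arbitrary sets of cells, so that the shapes that arise when entries are
removed can be described by functions instead of lists.\<close>

definition tableaux :: "(nat \<times> nat) set \<Rightarrow> nat \<Rightarrow> (nat \<times> nat \<Rightarrow> nat) set" where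
  "tableaux D N = {T \<in> D \<rightarrow>\<^sub>E {..<N}.
     (\<forall>i j j'. (i, j) \<in> D \<longrightarrow> (i, j') \<in> D \<longrightarrow> j < j' \<longrightarrow> T (i, j) \<le> T (i, j')) \<and>
     (\<forall>i i' j. (i, j) \<in> D \<longrightarrow> (i', j) \<in> D \<longrightarrow> i < i' \<longrightarrow> T (i, j) < T (i', j))}"

definition tableau_sum :: "(nat \<times> nat) set \<Rightarrow> 'a::comm_semiring_1 list \<Rightarrow> 'a" where
  "tableau_sum D xs = (\<Sum>T\<in>tableaux D (length xs). \<Prod>c\<in>D. xs ! T c)"

text \<open>The row bounds are functions because the shapes left over after removing the largest entry are
then indexed by a product of intervals, which is also the index set produced by expanding a
determinant along all its rows.\<close>

definition shape :: "nat \<Rightarrow> (nat \<Rightarrow> nat) \<Rightarrow> (nat \<Rightarrow> nat) \<Rightarrow> (nat \<times> nat) set" where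
  "shape r f g = (SIGMA i:{..<r}. {g i..<f i})"

lemma mem_shape [simp]: "(i, j) \<in> shape r f g \<longleftrightarrow> i < r \<and> g i \<le> j \<and> j < f i"
  by (auto simp: shape_def)

lemma finite_shape [simp]: "finite (shape r f g)"
  by (simp add: shape_def)

lemma tableaux_less: "T \<in> tableaux D N \<Longrightarrow> c \<in> D \<Longrightarrow> T c < N"
  by (cases c) (auto simp: tableaux_def PiE_def Pi_def)

lemma finite_tableaux: "finite D \<Longrightarrow> finite (tableaux D N)"
  by (rule finite_subset[of _ "D \<rightarrow>\<^sub>E {..<N}"]) (auto simp: tableaux_def intro!: finite_PiE)

text \<open>The default value \<open>0\<close> below the last row is the length of an empty row.\<close>

definition next_row :: "nat \<Rightarrow> (nat \<Rightarrow> nat) \<Rightarrow> nat \<Rightarrow> nat" where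
  "next_row r f i = (if Suc i < r then f (Suc i) else 0)"

text \<open>In a tableau with entries at most \<open>N\<close>, the cells with entries below \<open>N\<close> are a shape again, since rows
increase; \<open>v i\<close> is the end of its \<open>i\<close>th row. Strictness in the columns says that each column contains
at most one \<open>N\<close>, which is the bound of \<open>v i\<close> by the next row.\<close>

lemma tableaux_split_largest:
  assumes f: "antimono_on {..<r} f" and g: "antimono_on {..<r} g"
    and T: "T \<in> tableaux (shape r f g) (Suc N)" and gf: "\<And>i. i < r \<Longrightarrow> g i \<le> f i"
  obtains v where "v \<in> (\<Pi>\<^sub>E i\<in>{..<r}. {max (g i) (next_row r f i)..f i})"
    and "\<And>i j. i < r \<Longrightarrow> g i \<le> j \<Longrightarrow> j < f i \<Longrightarrow> T (i, j) < N \<longleftrightarrow> j < v i"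
proof -
  (* The least j with P i j is the first column of row i that holds an N or lies beyond the row. *)
  define P where "P i j \<longleftrightarrow> g i \<le> j \<and> (j < f i \<longrightarrow> N \<le> T (i, j))" for i j
  define v where "v = (\<lambda>i\<in>{..<r}. LEAST j. P i j)"
  have row: "T (i, j) \<le> T (i, j')" if "i < r" "g i \<le> j" "j \<le> j'" "j' < f i" for i j j'
    using T that by (cases "j = j'") (auto simp: tableaux_def)
  have col: "T (i, j) < T (Suc i, j)" if "Suc i < r" "g i \<le> j" "j < f (Suc i)" for i j
  proof -
    have "g (Suc i) \<le> g i" "f (Suc i) \<le> f i"
      using f g that by (auto simp: monotone_on_def)
    then show ?thesis using T that by (auto simp: tableaux_def)
  qed
  have bound: "T (i, j) \<le> N" if "i < r" "g i \<le> j" "j < f i" for i j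
  proof -
    have "T (i, j) \<in> {..<Suc N}" using T that by (auto simp: tableaux_def PiE_def Pi_def)
    then show ?thesis by simp
  qed
  have Pf: "P i (f i)" if "i < r" for i using gf that by (auto simp: P_def)
  have v1: "P i (v i)" and v2: "v i \<le> f i" if "i < r" for i
    using that LeastI[of "P i", OF Pf] Least_le[of "P i", OF Pf] by (auto simp: v_def)
  have key: "T (i, j) < N \<longleftrightarrow> j < v i" if "i < r" "g i \<le> j" "j < f i" for i j
  proof
    assume "j < v i"
    then have "\<not> P i j" using that not_less_Least[of j "P i"] by (auto simp: v_def)
    then show "T (i, j) < N" using that by (auto simp: P_def)
  next
    assume *: "T (i, j) < N"
    show "j < v i"
    proof (rule ccontr)
      assume "\<not> j < v i"
      then have "T (i, v i) \<le> T (i, j)" using v1[of i] that by (intro row) (auto simp: P_def)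
      then show False using * v1[of i] that \<open>\<not> j < v i\<close> by (auto simp: P_def)
    qed
  qed
  have nxt: "next_row r f i \<le> v i" if "i < r" for i
  proof (cases "Suc i < r \<and> v i < f (Suc i)")
    case True
    then have "T (i, v i) < T (Suc i, v i)" using v1[of i] that by (intro col) (auto simp: P_def)
    moreover have "T (Suc i, v i) \<le> N"
    proof -
      have "g (Suc i) \<le> g i" using g that True by (auto simp: monotone_on_def)
      then show ?thesis using True v1[of i] that by (intro bound) (auto simp: P_def)
    qed
    moreover have "f (Suc i) \<le> f i" using f that True by (auto simp: monotone_on_def)
    ultimately show ?thesis using key[of i "v i"] v1[of i] True that by (auto simp: P_def)
  qed (auto simp: next_row_def)
  show ?thesis
    by (rule that[of v]) (use key v1 v2 nxt in \<open>auto simp: v_def P_def\<close>)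
qed

text \<open>Summation over the possible positions of the largest entry: the cells that contain it form a
horizontal strip \<open>f/v\<close>, and they contribute one factor \<open>x\<close> each.\<close>

lemma tableau_sum_snoc:
  fixes x :: "'a::comm_semiring_1"
  assumes f: "antimono_on {..<r} f" and g: "antimono_on {..<r} g"
    and gf: "\<And>i. i < r \<Longrightarrow> g i \<le> f i"
  shows "tableau_sum (shape r f g) (xs @ [x]) =
    (\<Sum>v\<in>(\<Pi>\<^sub>E i\<in>{..<r}. {max (g i) (next_row r f i)..f i}).
       (\<Prod>i<r. x ^ (f i - v i)) * tableau_sum (shape r v g) xs)"
proof -
  define N where "N = length xs"
  define V where "V = (\<Pi>\<^sub>E i\<in>{..<r}. {max (g i) (next_row r f i)..f i})"
  have finV: "finite V" by (auto simp: V_def intro: finite_PiE)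
  have V: "g i \<le> v i" "v i \<le> f i" "next_row r f i \<le> v i" if "v \<in> V" "i < r" for v i
    using that by (auto simp: V_def PiE_def Pi_def)
  have Vf: "f i' \<le> v i" if "v \<in> V" "i < i'" "i' < r" for v i i'
  proof -
    have "f i' \<le> f (Suc i)" using f that by (auto simp: monotone_on_def)
    also have "\<dots> \<le> v i" using V(3)[of v i] that by (auto simp: next_row_def)
    finally show ?thesis .
  qed
  have sub: "shape r v g \<subseteq> shape r f g" if "v \<in> V" for v
    using V[OF that] by (fastforce simp: shape_def)
  (* A tableau on the smaller shape is extended by the value N on the strip. *)
  define join where "join = (\<lambda>(v, T). restrict (\<lambda>c. if c \<in> shape r v g then T c else N) (shape r f g))"
  define X where "X = (SIGMA v:V. tableaux (shape r v g) N)"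
  have weight: "(\<Prod>c\<in>shape r f g. (xs @ [x]) ! join (v, T) c) =
      (\<Prod>i<r. x ^ (f i - v i)) * (\<Prod>c\<in>shape r v g. xs ! T c)"
    if v: "v \<in> V" and T: "T \<in> tableaux (shape r v g) N" for v T
  proof -
    have TN: "T c < length xs" if "c \<in> shape r v g" for c
      using tableaux_less T that by (auto simp only: N_def)
    have split: "shape r f g = shape r v g \<union> shape r f v"
      using V[OF v] by (fastforce simp: shape_def)
    have disj: "shape r v g \<inter> shape r f v = {}" by (auto simp: shape_def)
    have "(\<Prod>c\<in>shape r f g. (xs @ [x]) ! join (v, T) c) =
       (\<Prod>c\<in>shape r v g. (xs @ [x]) ! join (v, T) c) * (\<Prod>c\<in>shape r f v. (xs @ [x]) ! join (v, T) c)"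
      unfolding split by (rule prod.union_disjoint) (use disj in auto)
    also have "(\<Prod>c\<in>shape r v g. (xs @ [x]) ! join (v, T) c) = (\<Prod>c\<in>shape r v g. xs ! T c)"
      by (rule prod.cong) (use sub[OF v] TN in \<open>auto simp: join_def nth_append\<close>)
    also have "(\<Prod>c\<in>shape r f v. (xs @ [x]) ! join (v, T) c) = (\<Prod>c\<in>shape r f v. x)"
      by (rule prod.cong) (use split in \<open>auto simp: join_def nth_append N_def shape_def\<close>)
    also have "\<dots> = (\<Prod>i<r. x ^ (f i - v i))"
      unfolding shape_def by (simp add: prod.Sigma[symmetric] power_sum)
    finally show ?thesis by (simp add: mult.commute)
  qed
  have inj: "inj_on join X"
  proof (rule inj_onI)
    fix a b assume "a \<in> X" "b \<in> X" and e: "join a = join b"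
    then obtain v T v' T' where ab: "a = (v, T)" "b = (v', T')" and v: "v \<in> V" "v' \<in> V"
      and T: "T \<in> tableaux (shape r v g) N" "T' \<in> tableaux (shape r v' g) N"
      by (auto simp: X_def)
    have TN: "T c < N" if "c \<in> shape r v g" for c
      using tableaux_less T that by (auto simp only: N_def)
    have TN': "T' c < N" if "c \<in> shape r v' g" for c
      using tableaux_less T that by (auto simp only: N_def)
    have e': "join a c = join b c" for c using e by simp
    have *: "c \<in> shape r v g \<longleftrightarrow> c \<in> shape r v' g" for c
      using e'[of c] sub[OF v(1)] sub[OF v(2)] TN[of c] TN'[of c]
      by (auto simp: ab join_def restrict_def split: if_splits)
    then have sh: "shape r v g = shape r v' g" by auto
    have "v i = v' i" if "i < r" for i
    proof (rule ccontr)
      assume "v i \<noteq> v' i"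
      then show False
        using *[of "(i, min (v i) (v' i))"] V(1)[OF v(1) that] V(1)[OF v(2) that] that
        by (auto simp: min_def split: if_splits)
    qed
    then have vv: "v = v'" using v by (intro PiE_ext[of v _ _ v']) (auto simp: V_def)
    have "T c = T' c" if "c \<in> shape r v g" for c
      using e'[of c] sub[OF v(1)] that sh by (auto simp: ab join_def)
    then have "T = T'"
      using T sh by (intro PiE_ext[of T "shape r v g" "\<lambda>_. {..<N}" T']) (auto simp: tableaux_def)
    then show "a = b" using ab vv by simp
  qed
  have "join ` X = tableaux (shape r f g) (Suc N)"
  proof (intro equalityI subsetI)
    fix S assume "S \<in> join ` X"
    then obtain v T where S: "S = join (v, T)" and v: "v \<in> V" and T: "T \<in> tableaux (shape r v g) N"
      by (auto simp: X_def)
    have TN: "T c < N" if "c \<in> shape r v g" for c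
      using tableaux_less T that by (auto simp only: N_def)
    have "S c < Suc N" if "c \<in> shape r f g" for c
      using TN[of c] that by (auto simp: S join_def)
    then have "S \<in> shape r f g \<rightarrow>\<^sub>E {..<Suc N}"
      by (auto simp: S join_def)
    moreover have "S (i, j) \<le> S (i, j')"
      if "(i, j) \<in> shape r f g" "(i, j') \<in> shape r f g" "j < j'" for i j j'
      using T that TN[of "(i,j)"] by (auto simp: S join_def tableaux_def)
    moreover have "S (i, j) < S (i', j)"
      if a: "(i, j) \<in> shape r f g" "(i', j) \<in> shape r f g" "i < i'" for i i' j
    proof -
      have "f i' \<le> v i" using a v by (intro Vf) auto
      then have "(i, j) \<in> shape r v g" using a by auto
      then show ?thesis
        using T a TN[of "(i,j)"] by (auto simp: S join_def tableaux_def)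
    qed
    ultimately show "S \<in> tableaux (shape r f g) (Suc N)" unfolding tableaux_def by blast
  next
    fix S assume S: "S \<in> tableaux (shape r f g) (Suc N)"
    from tableaux_split_largest[OF f g S gf] obtain v where v: "v \<in> V"
      and sv: "\<And>i j. i < r \<Longrightarrow> g i \<le> j \<Longrightarrow> j < f i \<Longrightarrow> S (i, j) < N \<longleftrightarrow> j < v i"
      unfolding V_def by blast
    define T where "T = restrict S (shape r v g)"
    have SN: "S c < Suc N" if "c \<in> shape r f g" for c
      using tableaux_less[OF S that] .
    have "T \<in> tableaux (shape r v g) N"
      using S sv V[OF v] sub[OF v] unfolding tableaux_def T_def by (force simp: subset_iff)
    moreover have "S = join (v, T)"
    proof
      fix c show "S c = join (v, T) c"
      proof (cases "c \<in> shape r f g")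
        case True
        obtain i j where c: "c = (i, j)" by force
        show ?thesis using True sv[of i j] SN[of c] by (auto simp: c join_def T_def)
      next
        case False
        have "S \<in> extensional (shape r f g)" using S by (auto simp: tableaux_def PiE_def)
        then show ?thesis using False by (simp add: join_def extensional_arb[OF _ False])
      qed
    qed
    ultimately show "S \<in> join ` X" using v by (auto simp: X_def)
  qed
  then have "tableau_sum (shape r f g) (xs @ [x]) =
      (\<Sum>S\<in>join ` X. \<Prod>c\<in>shape r f g. (xs @ [x]) ! S c)"
    by (simp add: tableau_sum_def N_def)
  also have "\<dots> = (\<Sum>(v, T)\<in>X. (\<Prod>i<r. x ^ (f i - v i)) * (\<Prod>c\<in>shape r v g. xs ! T c))"
    by (subst sum.reindex[OF inj]) (auto simp: X_def weight intro!: sum.cong)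
  also have "\<dots> = (\<Sum>v\<in>V. \<Sum>T\<in>tableaux (shape r v g) N.
      (\<Prod>i<r. x ^ (f i - v i)) * (\<Prod>c\<in>shape r v g. xs ! T c))"
    unfolding X_def using finV by (subst sum.Sigma) (auto intro: finite_tableaux)
  finally show ?thesis by (simp add: V_def tableau_sum_def N_def sum_distrib_left)
qed

section \<open>Complete symmetric polynomials and the Jacobi-Trudi identity\<close>

definition hsym_fps :: "'a::comm_ring_1 list \<Rightarrow> 'a fps" where
  "hsym_fps xs = (\<Prod>x\<leftarrow>xs. Abs_fps (\<lambda>n. x ^ n))"

text \<open>The complete homogeneous symmetric polynomial of degree \<open>k\<close>; integer degrees, with value \<open>0\<close> at
negative ones, match the entries of Jacobi-Trudi matrices.\<close>

definition hsym :: "'a::comm_ring_1 list \<Rightarrow> int \<Rightarrow> 'a" where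
  "hsym xs k = (if k < 0 then 0 else fps_nth (hsym_fps xs) (nat k))"

lemma hsym_neg [simp]: "k < 0 \<Longrightarrow> hsym xs k = 0"
  by (simp add: hsym_def)

lemma hsym_Nil: "hsym [] k = (if k = 0 then 1 else 0)"
  by (auto simp: hsym_def hsym_fps_def)

lemma geometric_fps:
  fixes x :: "'a::comm_ring_1"
  shows "Abs_fps (\<lambda>n. x ^ n) = 1 + fps_X * (fps_const x * Abs_fps (\<lambda>n. x ^ n))"
proof (rule fps_ext)
  fix n
  show "fps_nth (Abs_fps (\<lambda>n. x ^ n)) n =
      fps_nth (1 + fps_X * (fps_const x * Abs_fps (\<lambda>n. x ^ n))) n"
    by (cases n) simp_all
qed

text \<open>Multiplying the generating function by \<open>1/(1 - x X)\<close> adds a variable; clearing the denominator gives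
the recursion.\<close>

lemma hsym_snoc: "hsym (xs @ [x]) k = hsym xs k + x * hsym (xs @ [x]) (k - 1)"
proof -
  have "hsym_fps (xs @ [x]) = hsym_fps xs * Abs_fps (\<lambda>n. x ^ n)"
    by (simp add: hsym_fps_def)
  also have "\<dots> = hsym_fps xs * (1 + fps_X * (fps_const x * Abs_fps (\<lambda>n. x ^ n)))"
    by (subst geometric_fps) (rule refl)
  also have "\<dots> = hsym_fps xs + fps_const x * (fps_X * hsym_fps (xs @ [x]))"
    by (simp add: hsym_fps_def algebra_simps)
  finally have *: "hsym_fps (xs @ [x]) = \<dots>" .
  have nth: "fps_nth (hsym_fps (xs @ [x])) n =
      fps_nth (hsym_fps xs) n + (if n = 0 then 0 else x * fps_nth (hsym_fps (xs @ [x])) (n - 1))" for n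
    by (subst *) (simp add: fps_X_mult_nth)
  consider "k < 0" | "k = 0" | "k > 0" by linarith
  then show ?thesis
  proof cases
    case 3
    then have "nat (k - 1) = nat k - 1" by simp
    with 3 nth[of "nat k"] show ?thesis by (simp add: hsym_def)
  qed (use nth[of 0] in \<open>auto simp: hsym_def\<close>)
qed

lemma hsym_snoc_telescope:
  "hsym (xs @ [x]) k =
    (\<Sum>c<n. x ^ c * hsym xs (k - int c)) + x ^ n * hsym (xs @ [x]) (k - int n)"
proof (induction n)
  case (Suc n)
  have "hsym (xs @ [x]) (k - int n) =
      hsym xs (k - int n) + x * hsym (xs @ [x]) (k - int (Suc n))"
    by (subst hsym_snoc) (simp add: algebra_simps)
  with Suc show ?case by (simp add: algebra_simps)
qed simp

lemma det_mat: "det (mat n n (\<lambda>(i, j). m i j)) =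
    (\<Sum>p | p permutes {..<n}. signof p * (\<Prod>i<n. m i (p i)))"
proof -
  have "(\<Prod>i = 0..<n. mat n n (\<lambda>(i, j). m i j) $$ (i, p i)) = (\<Prod>i<n. m i (p i))"
    if "p permutes {..<n}" for p
  proof (rule prod.cong)
    fix i assume "i \<in> {..<n}"
    moreover have "p i < n" using permutes_in_image[OF that, of i] \<open>i \<in> {..<n}\<close> by simp
    ultimately show "mat n n (\<lambda>(i, j). m i j) $$ (i, p i) = m i (p i)" by simp
  qed auto
  then show ?thesis by (simp add: det_def atLeast0LessThan)
qed

text \<open>Multilinearity in all rows at once: both sides are the Leibniz formula, with a product of sums
expanded into a sum over choice functions.\<close>

lemma det_linear_rows:
  assumes "\<And>i. i < n \<Longrightarrow> finite (S i)"
  shows "det (mat n n (\<lambda>(i, j). \<Sum>c\<in>S i. w i c * m i c j)) =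
    (\<Sum>v\<in>(\<Pi>\<^sub>E i\<in>{..<n}. S i). (\<Prod>i<n. w i (v i)) * det (mat n n (\<lambda>(i, j). m i (v i) j)))"
proof -
  have "(\<Prod>i<n. \<Sum>c\<in>S i. w i c * m i c (p i)) =
      (\<Sum>v\<in>(\<Pi>\<^sub>E i\<in>{..<n}. S i). (\<Prod>i<n. w i (v i)) * (\<Prod>i<n. m i (v i) (p i)))" for p
    using assms by (subst prod_sum_PiE) (auto simp: prod.distrib)
  then show ?thesis
    by (simp add: det_mat sum_distrib_left mult_ac) (rule sum.swap)
qed

definition jacobi_trudi :: "nat \<Rightarrow> (nat \<Rightarrow> nat) \<Rightarrow> (nat \<Rightarrow> nat) \<Rightarrow> 'a::comm_ring_1 list \<Rightarrow> 'a" where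
  "jacobi_trudi r f g xs =
     det (mat r r (\<lambda>(i, j). hsym xs ((int (f i) - int i) - (int (g j) - int j))))"

text \<open>The determinantal counterpart of removing the largest entry. Subtracting from each row the multiple
\<open>x\<^sup>q\<close> of the next row, with \<open>q\<close> the difference of the two bead positions, cuts the expansion of
\<open>hsym_snoc_telescope\<close> after \<open>q\<close> terms; what is left are entries in one variable less, and the
determinant is expanded by multilinearity.\<close>

lemma jacobi_trudi_snoc:
  fixes x :: "'a::comm_ring_1"
  assumes f: "antimono_on {..<r} f"
  shows "jacobi_trudi r f g (xs @ [x]) =
    (\<Sum>v\<in>(\<Pi>\<^sub>E i\<in>{..<r}. {next_row r f i..f i}).
       (\<Prod>i<r. x ^ (f i - v i)) * jacobi_trudi r v g xs)"
proof -
  define H where "H ys i j = hsym ys ((int (f i) - int i) - (int (g j) - int j))" for ys :: "'a list" and i j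
  define A where "A = mat r r (\<lambda>(i, j). H (xs @ [x]) i j)"
  define q where "q i = Suc (f i - next_row r f i)" for i
  (* The unitriangular matrix of the simultaneous row operations. *)
  define U where "U = mat r r (\<lambda>(i, k). if k = i then 1 else if k = Suc i then - (x ^ q i) else 0)"
  have next_le: "next_row r f i \<le> f i" if "i < r" for i
    using f that by (auto simp: next_row_def monotone_on_def)
  have carr: "A \<in> carrier_mat r r" "U \<in> carrier_mat r r" by (auto simp: A_def U_def)
  have "upper_triangular U" by (auto simp: U_def)
  then have "det U = prod_list (diag_mat U)" by (rule det_upper_triangular[OF _ carr(2)])
  also have "diag_mat U = map (\<lambda>_. 1) [0..<r]" by (auto simp: diag_mat_def U_def)
  also have "prod_list \<dots> = 1" by (induction r) auto
  finally have detU: "det U = 1" .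
  (* In the last row nothing is subtracted, but there the remainder of the telescope has negative degree. *)
  have entry: "(U * A) $$ (i, j) =
      (\<Sum>c\<in>{next_row r f i..f i}. x ^ (f i - c) * hsym xs ((int c - int i) - (int (g j) - int j)))"
    if ij: "i < r" "j < r" for i j
  proof -
    define k where "k = (int (f i) - int i) - (int (g j) - int j)"
    have "(U * A) $$ (i, j) =
        (\<Sum>l = 0..<r. (if l = i then 1 else if l = Suc i then - (x ^ q i) else 0) * H (xs @ [x]) l j)"
      using ij by (simp add: A_def U_def scalar_prod_def)
    also have "\<dots> = (\<Sum>l\<in>{0..<r}. (if l = i then H (xs @ [x]) i j else 0) +
        (if l = Suc i then - (x ^ q i) * H (xs @ [x]) (Suc i) j else 0))"
      by (rule sum.cong) auto
    also have "\<dots> = H (xs @ [x]) i j + (if Suc i < r then - (x ^ q i) * H (xs @ [x]) (Suc i) j else 0)"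
      using ij by (simp add: sum.distrib)
    also have "H (xs @ [x]) i j = (\<Sum>c<q i. x ^ c * hsym xs (k - int c)) +
        x ^ q i * hsym (xs @ [x]) (k - int (q i))"
      unfolding H_def k_def by (rule hsym_snoc_telescope)
    also have "hsym (xs @ [x]) (k - int (q i)) = (if Suc i < r then H (xs @ [x]) (Suc i) j else 0)"
      using next_le[OF ij(1)] ij by (auto simp: H_def k_def q_def next_row_def of_nat_diff algebra_simps)
    finally have "(U * A) $$ (i, j) = (\<Sum>c<q i. x ^ c * hsym xs (k - int c))" by auto
    also have "\<dots> = (\<Sum>c\<in>{next_row r f i..f i}. x ^ (f i - c) * hsym xs (k - int (f i - c)))"
      by (rule sum.reindex_bij_witness[of _ "\<lambda>c. f i - c" "\<lambda>c. f i - c"])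
        (use next_le[OF ij(1)] in \<open>auto simp: q_def\<close>)
    also have "\<dots> = (\<Sum>c\<in>{next_row r f i..f i}. x ^ (f i - c) * hsym xs ((int c - int i) - (int (g j) - int j)))"
      by (rule sum.cong) (auto simp: k_def of_nat_diff algebra_simps)
    finally show ?thesis .
  qed
  have "jacobi_trudi r f g (xs @ [x]) = det U * det A"
    by (simp add: jacobi_trudi_def A_def H_def detU)
  also have "\<dots> = det (U * A)" by (rule det_mult[symmetric, OF carr(2,1)])
  also have "U * A = mat r r (\<lambda>(i, j). \<Sum>c\<in>{next_row r f i..f i}.
      x ^ (f i - c) * hsym xs ((int c - int i) - (int (g j) - int j)))"
    by (rule eq_matI) (use carr entry in auto)
  also have "det \<dots> = (\<Sum>v\<in>(\<Pi>\<^sub>E i\<in>{..<r}. {next_row r f i..f i}).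
      (\<Prod>i<r. x ^ (f i - v i)) * jacobi_trudi r v g xs)"
    unfolding jacobi_trudi_def by (rule det_linear_rows) auto
  finally show ?thesis .
qed

text \<open>A finite set can be listed in decreasing order in only one way.\<close>

lemma strict_dec_determined_by_image:
  fixes a b :: "nat \<Rightarrow> 'a::linorder"
  assumes "\<And>i j. i < j \<Longrightarrow> j < r \<Longrightarrow> a j < a i" and "\<And>i j. i < j \<Longrightarrow> j < r \<Longrightarrow> b j < b i"
    and "a ` {..<r} = b ` {..<r}"
  shows "\<forall>i<r. a i = b i"
proof -
  have sorted: "sorted_wrt (<) (rev (map c [0..<r]))"
    if "\<And>i j. i < j \<Longrightarrow> j < r \<Longrightarrow> c j < c i" for c :: "nat \<Rightarrow> 'a"
    unfolding sorted_wrt_rev using that by (simp add: sorted_wrt_iff_nth_less)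
  have "rev (map b [0..<r]) = rev (map a [0..<r])"
    by (rule strict_sorted_equal[OF sorted sorted])
      (use assms in \<open>auto simp: atLeast0LessThan\<close>)
  then show ?thesis by simp
qed

text \<open>Without variables \<open>h\<^sub>k\<close> is \<open>1\<close> for \<open>k = 0\<close> and \<open>0\<close> otherwise. A nonvanishing term of the Leibniz
formula then matches the bead positions of \<open>f\<close> with those of \<open>g\<close>; both are decreasing, so they coincide.\<close>

lemma jacobi_trudi_Nil:
  assumes f: "antimono_on {..<r} f" and g: "antimono_on {..<r} g"
  shows "jacobi_trudi r f g ([] :: 'a::comm_ring_1 list) = (if \<forall>i<r. f i = g i then 1 else 0)"
proof -
  define a where "a i = int (f i) - int i" for i
  define b where "b i = int (g i) - int i" for i
  have dec: "a i' < a i" "b i' < b i" if "i < i'" "i' < r" for i i'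
  proof -
    have "f i' \<le> f i" "g i' \<le> g i" using f g that by (auto simp: monotone_on_def)
    then show "a i' < a i" "b i' < b i" using that by (auto simp: a_def b_def)
  qed
  have inj: "inj_on a {..<r}" "inj_on b {..<r}"
    by (intro linorder_inj_onI; use dec in force)+
  have M: "jacobi_trudi r f g ([] :: 'a list) = det (mat r r (\<lambda>(i, j). if a i = b j then 1 else 0))"
    by (simp add: jacobi_trudi_def hsym_Nil a_def b_def)
  show ?thesis
  proof (cases "\<forall>i<r. f i = g i")
    case True
    then have ab: "a i = b i" if "i < r" for i using that by (simp add: a_def b_def)
    have "a i = b j \<longleftrightarrow> i = j" if "i < r" "j < r" for i j
      using inj_on_eq_iff[OF inj(2), of i j] that ab[of i] by simp
    then have "mat r r (\<lambda>(i, j). if a i = b j then 1 else 0) = (1\<^sub>m r :: 'a mat)"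
      by (intro eq_matI) simp_all
    then have "jacobi_trudi r f g ([] :: 'a list) = 1" unfolding M by simp
    then show ?thesis using True by simp
  next
    case False
    have mismatch: "\<not> p permutes {..<r} \<or> (\<exists>i<r. a i \<noteq> b (p i))" for p
    proof (rule ccontr)
      assume "\<not> ?thesis"
      then have p: "p permutes {..<r}" and ab: "\<And>i. i < r \<Longrightarrow> a i = b (p i)" by blast+
      have "a ` {..<r} = b ` p ` {..<r}" unfolding image_image by (rule image_cong) (use ab in simp_all)
      then have "a ` {..<r} = b ` {..<r}" using permutes_image[OF p] by simp
      then have "\<forall>i<r. a i = b i"
        using strict_dec_determined_by_image[of r a b] dec by blast
      then have "f i = g i" if "i < r" for i using that by (simp add: a_def b_def)
      then show False using False by blast
    qed
    have "(\<Prod>i<r. if a i = b (p i) then 1 else 0 :: 'a) = 0" if p: "p permutes {..<r}" for p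
    proof -
      obtain i where "i < r" "a i \<noteq> b (p i)" using mismatch[of p] p by blast
      then have "(\<Prod>i\<in>{..<r}. if a i = b (p i) then 1 else 0 :: 'a) = 0"
        by (subst prod.remove[of _ i]) auto
      then show ?thesis .
    qed
    then have "(\<Sum>p | p permutes {..<r}. signof p * (\<Prod>i<r. if a i = b (p i) then 1 else 0 :: 'a)) = 0"
      by (intro sum.neutral) auto
    then show ?thesis unfolding M det_mat using False by (simp only: if_False)
  qed
qed

lemma shape_empty: "shape r f g = {} \<longleftrightarrow> (\<forall>i<r. f i \<le> g i)"
  by (fastforce simp: shape_def)

lemma tableau_sum_Nil: "tableau_sum D [] = (if D = {} then 1 else 0)"
proof (cases "D = {}")
  case True
  then have "tableaux D 0 = {\<lambda>_. undefined}" by (auto simp: tableaux_def)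
  then show ?thesis using True by (simp add: tableau_sum_def)
next
  case False
  then have "tableaux D 0 = {}" by (auto simp: tableaux_def PiE_def Pi_def)
  then show ?thesis using False by (simp add: tableau_sum_def)
qed

text \<open>Induction on the number of variables: determinant and tableau sum obey the same recursion. The
determinant sums over strips without regard to \<open>g\<close>, and the induction hypothesis makes the terms
vanish whose shape does not contain that of \<open>g\<close>.\<close>

theorem jacobi_trudi:
  fixes xs :: "'a::comm_ring_1 list"
  assumes "antimono_on {..<r} f" and g: "antimono_on {..<r} g"
  shows "jacobi_trudi r f g xs =
    (if \<forall>i<r. g i \<le> f i then tableau_sum (shape r f g) xs else 0)"
  using assms(1)
proof (induction xs arbitrary: f rule: rev_induct)
  case Nil
  have "f i = g i \<longleftrightarrow> g i \<le> f i \<and> f i \<le> g i" for i by linarith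
  then have "(\<forall>i<r. f i = g i) \<longleftrightarrow> (\<forall>i<r. g i \<le> f i) \<and> shape r f g = {}"
    unfolding shape_empty by blast
  then show ?case
    using jacobi_trudi_Nil[OF Nil g, where ?'a = 'a] tableau_sum_Nil[of "shape r f g", where ?'a = 'a]
    by (cases "\<forall>i<r. g i \<le> f i"; cases "shape r f g = {}") simp_all
next
  case (snoc x xs)
  note f = snoc.prems
  define V where "V = (\<Pi>\<^sub>E i\<in>{..<r}. {next_row r f i..f i})"
  define W where "W = (\<Pi>\<^sub>E i\<in>{..<r}. {max (g i) (next_row r f i)..f i})"
  have mono: "antimono_on {..<r} v" if "v \<in> V" for v
  proof (rule monotone_onI)
    fix i i' assume *: "i \<in> {..<r}" "i' \<in> {..<r}" "i \<le> i'"
    show "v i' \<le> v i"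
    proof (cases "i = i'")
      case False
      then have "f i' \<le> f (Suc i)" using f * by (auto simp: monotone_on_def)
      moreover have "v i' \<le> f i'" "next_row r f i \<le> v i" using that * by (auto simp: V_def PiE_def Pi_def)
      ultimately show ?thesis using * False by (auto simp: next_row_def)
    qed auto
  qed
  have eq: "jacobi_trudi r f g (xs @ [x]) = (\<Sum>v\<in>V. (\<Prod>i<r. x ^ (f i - v i)) *
      (if \<forall>i<r. g i \<le> v i then tableau_sum (shape r v g) xs else 0))"
    unfolding jacobi_trudi_snoc[OF f] V_def[symmetric]
    by (rule sum.cong) (simp_all add: snoc.IH mono)
  have le: "v i \<le> f i" if "v \<in> V" "i < r" for v i using that by (auto simp: V_def PiE_def Pi_def)
  show ?case
  proof (cases "\<forall>i<r. g i \<le> f i")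
    case True
    have "jacobi_trudi r f g (xs @ [x]) =
        (\<Sum>v\<in>W. (\<Prod>i<r. x ^ (f i - v i)) * tableau_sum (shape r v g) xs)"
      unfolding eq
    proof (rule sum.mono_neutral_cong_right)
      show "finite V" by (auto simp: V_def intro: finite_PiE)
      show "W \<subseteq> V" by (force simp: V_def W_def PiE_def Pi_def)
    qed (auto simp: V_def W_def PiE_def Pi_def)
    also have "\<dots> = tableau_sum (shape r f g) (xs @ [x])"
      unfolding W_def by (rule tableau_sum_snoc[symmetric, OF f g]) (use True in auto)
    finally show ?thesis using True by simp
  next
    case False
    then obtain i where i: "i < r" "f i < g i" by (auto simp: not_le)
    have "\<not> (\<forall>i<r. g i \<le> v i)" if "v \<in> V" for v
      using le[OF that i(1)] i by (meson le_trans not_le)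
    then have "jacobi_trudi r f g (xs @ [x]) = 0"
      unfolding eq by (intro sum.neutral ballI) (simp only: if_False mult_zero_right)
    then show ?thesis using False by (simp only: if_False)
  qed
qed

section \<open>Power sums and Newton's identities\<close>

definition psum :: "'a::comm_ring_1 list \<Rightarrow> nat \<Rightarrow> 'a" where
  "psum xs k = (\<Sum>x\<leftarrow>xs. x ^ k)"

lemma hsym_of_nat: "hsym xs (int n) = fps_nth (hsym_fps xs) n"
  by (simp add: hsym_def)

text \<open>The logarithmic derivative of the generating function: each factor \<open>1/(1 - x X)\<close> contributes the
series of the powers of \<open>x\<close>.\<close>

lemma newton_fps:
  "fps_X * fps_deriv (hsym_fps xs) =
     hsym_fps xs * Abs_fps (\<lambda>k. if k = 0 then 0 else psum xs k)"
proof (induction xs)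
  case Nil
  have "Abs_fps (\<lambda>k. if k = 0 then 0 else psum [] k) = (0 :: 'a fps)"
    by (rule fps_ext) (simp add: psum_def)
  then show ?case by (simp add: hsym_fps_def)
next
  case (Cons x xs)
  define G where "G = Abs_fps (\<lambda>n. x ^ n)"
  define P where "P = (\<lambda>ys :: 'a list. Abs_fps (\<lambda>k. if k = 0 then 0 else psum ys k))"
  have C: "hsym_fps (x # xs) = G * hsym_fps xs" by (simp add: hsym_fps_def G_def)
  have "fps_X * fps_deriv G = G * P [x]"
  proof (rule fps_ext)
    fix n
    have "fps_nth (G * P [x]) n = (\<Sum>i\<in>{0..n}. if i = n then 0 else x ^ n)"
      unfolding fps_mult_nth
      by (rule sum.cong) (auto simp: G_def P_def psum_def simp flip: power_add)
    also have "\<dots> = (\<Sum>i\<in>{0..<n}. x ^ n)"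
      by (intro sum.mono_neutral_cong_right) auto
    finally show "fps_nth (fps_X * fps_deriv G) n = fps_nth (G * P [x]) n"
      by (cases n) (simp_all add: G_def)
  qed
  moreover have "P (x # xs) = P [x] + P xs"
    by (rule fps_ext) (simp add: P_def psum_def)
  moreover have "fps_X * fps_deriv (G * hsym_fps xs) =
      (fps_X * fps_deriv G) * hsym_fps xs + G * (fps_X * fps_deriv (hsym_fps xs))"
    by (simp add: algebra_simps)
  moreover have "fps_X * fps_deriv (hsym_fps xs) = hsym_fps xs * P xs"
    unfolding P_def by (rule Cons.IH)
  ultimately have "fps_X * fps_deriv (hsym_fps (x # xs)) = hsym_fps (x # xs) * P (x # xs)"
    unfolding C by (simp only: algebra_simps)
  then show ?case by (simp only: P_def)
qed

theorem newton:
  "of_nat n * hsym xs (int n) = (\<Sum>k=1..n. psum xs k * hsym xs (int (n - k)))"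
proof -
  have "of_nat n * hsym xs (int n) = fps_nth (fps_X * fps_deriv (hsym_fps xs)) n"
    unfolding hsym_of_nat by (cases n) simp_all
  also have "\<dots> = (\<Sum>i=0..n. (if i = 0 then 0 else psum xs i) * hsym xs (int (n - i)))"
    unfolding newton_fps hsym_of_nat by (subst mult.commute) (simp add: fps_mult_nth)
  also have "\<dots> = (\<Sum>k=1..n. psum xs k * hsym xs (int (n - k)))"
    by (rule sum.mono_neutral_cong_right) auto
  finally show ?thesis .
qed

text \<open>Multisets replace lists of parts, because the arguments below insert, remove and merge parts.\<close>

definition parts_of :: "nat \<Rightarrow> nat multiset set" where
  "parts_of n = {M. 0 \<notin># M \<and> \<Sum>\<^sub># M = n}"

definition pprod :: "nat multiset \<Rightarrow> 'a::comm_ring_1 list \<Rightarrow> 'a" where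
  "pprod M xs = (\<Prod>k\<in>#M. psum xs k)"

definition zmult :: "nat multiset \<Rightarrow> nat" where
  "zmult M = (\<Prod>j\<in>set_mset M. fact (count M j) * j ^ count M j)"

lemma finite_parts_of: "finite (parts_of n)"
proof (rule finite_subset)
  show "finite (mset ` {xs. set xs \<subseteq> {..n} \<and> length xs \<le> n})"
    by (intro finite_imageI finite_lists_length_le) simp
  show "parts_of n \<subseteq> mset ` {xs. set xs \<subseteq> {..n} \<and> length xs \<le> n}"
  proof
    fix M assume M: "M \<in> parts_of n"
    obtain xs where xs: "mset xs = M" using ex_mset by blast
    have "0 \<notin> set xs" "sum_list xs = n" using M by (auto simp: parts_of_def xs[symmetric] sum_mset_sum_list)
    moreover have "length xs \<le> sum_list xs" if "0 \<notin> set xs" for xs :: "nat list"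
      using that by (induction xs) auto
    ultimately show "M \<in> mset ` {xs. set xs \<subseteq> {..n} \<and> length xs \<le> n}"
      using xs member_le_sum_list[of _ xs] by (intro image_eqI[of _ _ xs]) auto
  qed
qed

lemma zmult_pos: "0 \<notin># M \<Longrightarrow> zmult M > 0"
  by (auto simp: zmult_def intro!: prod_pos intro: gr0I)

lemma zmult_superset:
  assumes "finite S" "set_mset M \<subseteq> S"
  shows "zmult M = (\<Prod>j\<in>S. fact (count M j) * j ^ count M j)"
  unfolding zmult_def
  by (rule prod.mono_neutral_cong_left) (use assms in \<open>auto simp: not_in_iff\<close>)

lemma zmult_add_mset: "zmult (add_mset j M) = j * Suc (count M j) * zmult M"
proof -
  define S where "S = insert j (set_mset M)"
  have S: "finite S" "j \<in> S" by (auto simp: S_def)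
  have "zmult (add_mset j M) = (\<Prod>k\<in>S. fact (count (add_mset j M) k) * k ^ count (add_mset j M) k)"
    by (rule zmult_superset) (auto simp: S_def)
  also have "\<dots> = fact (Suc (count M j)) * j ^ Suc (count M j) *
      (\<Prod>k\<in>S - {j}. fact (count M k) * k ^ count M k)"
    by (subst prod.remove[OF S]) (auto intro!: prod.cong)
  also have "\<dots> = j * Suc (count M j) * (\<Prod>k\<in>S. fact (count M k) * k ^ count M k)"
    by (subst prod.remove[OF S]) (simp add: algebra_simps)
  also have "(\<Prod>k\<in>S. fact (count M k) * k ^ count M k) = zmult M"
    by (rule zmult_superset[symmetric]) (auto simp: S_def)
  finally show ?thesis .
qed

text \<open>The quotient is a product of the binomial coefficients \<open>a + b choose a\<close> of multiplicities; this
divisibility is what keeps the product of two integral expansions integral.\<close>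

lemma zmult_union: "\<exists>b. zmult (A + B) = zmult A * zmult B * b"
proof
  define S where "S = set_mset (A + B)"
  have *: "fact (m + n) = fact m * fact n * ((m + n) choose m)" for m n :: nat
    using binomial_fact_lemma[of m "m + n"] by simp
  have "zmult (A + B) = (\<Prod>j\<in>S. fact (count (A + B) j) * j ^ count (A + B) j)"
    "zmult A = (\<Prod>j\<in>S. fact (count A j) * j ^ count A j)"
    "zmult B = (\<Prod>j\<in>S. fact (count B j) * j ^ count B j)"
    by (rule zmult_superset; simp add: S_def)+
  then show "zmult (A + B) = zmult A * zmult B * (\<Prod>j\<in>S. (count A j + count B j) choose count A j)"
    by (simp add: prod.distrib[symmetric] * power_add mult_ac)
qed

text \<open>Removing a part \<open>j\<close> is a bijection from partitions of \<open>n\<close> with a marked part size onto pairs of \<open>j\<close> and a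
partition of \<open>n - j\<close>.\<close>

lemma sum_parts_of_remove:
  "(\<Sum>M\<in>parts_of n. \<Sum>j\<in>set_mset M. F j (M - {#j#})) =
   (\<Sum>j=1..n. \<Sum>R\<in>parts_of (n - j). F j R)"
proof -
  have remove: "1 \<le> j \<and> j \<le> n \<and> M - {#j#} \<in> parts_of (n - j)" if M: "M \<in> parts_of n" "j \<in># M" for M j
  proof -
    obtain R where R: "M = add_mset j R" using multi_member_split[OF M(2)] by blast
    have "j \<noteq> 0" using M by (cases j) (auto simp: parts_of_def)
    then show ?thesis using M(1) by (auto simp: R parts_of_def)
  qed
  have insert: "add_mset j R \<in> parts_of n" if "1 \<le> j" "j \<le> n" "R \<in> parts_of (n - j)" for R j
    using that by (auto simp: parts_of_def)
  have "(\<Sum>M\<in>parts_of n. \<Sum>j\<in>set_mset M. F j (M - {#j#})) =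
      (\<Sum>(M, j)\<in>(SIGMA M:parts_of n. set_mset M). F j (M - {#j#}))"
    by (rule sum.Sigma) (auto simp: finite_parts_of)
  also have "\<dots> = (\<Sum>(j, R)\<in>(SIGMA j:{1..n}. parts_of (n - j)). F j R)"
    by (rule sum.reindex_bij_witness[of _ "\<lambda>(j, R). (add_mset j R, j)" "\<lambda>(M, j). (j, M - {#j#})"])
      (use remove insert in auto)
  also have "\<dots> = (\<Sum>j=1..n. \<Sum>R\<in>parts_of (n - j). F j R)"
    by (rule sum.Sigma[symmetric]) (auto simp: finite_parts_of)
  finally show ?thesis .
qed

lemma sum_mset_eq_sum_count:
  "(\<Sum>x\<in>#M. f x) = (\<Sum>x\<in>set_mset M. of_nat (count M x) * f x :: 'a::comm_semiring_1)"
proof -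
  have "(\<Sum>x\<in>#M. f x) = (\<Sum>x\<in>S. of_nat (count M x) * f x)" if "finite S" "set_mset M \<subseteq> S" for S
    using that(2)
  proof (induction M)
    case (add y M)
    have "(\<Sum>x\<in>S. of_nat (count (add_mset y M) x) * f x) =
        (\<Sum>x\<in>S. of_nat (count M x) * f x + (if y = x then f x else 0))"
      by (rule sum.cong) (auto simp: algebra_simps)
    also have "\<dots> = (\<Sum>x\<in>S. of_nat (count M x) * f x) + f y"
      using add that by (simp add: sum.distrib)
    finally show ?case using add by (simp add: add.commute)
  qed simp
  then show ?thesis by blast
qed

text \<open>The right side satisfies Newton's recursion: write \<open>n\<close> as the sum of the parts of \<open>M\<close>, and note that
dividing \<open>zmult M\<close> by \<open>j\<close> and the multiplicity of \<open>j\<close> removes the part \<open>j\<close>.\<close>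

lemma hsym_power_sum_expansion:
  fixes xs :: "'a::field_char_0 list"
  shows "hsym xs (int n) = (\<Sum>M\<in>parts_of n. pprod M xs / of_nat (zmult M))"
proof (induction n rule: less_induct)
  case (less n)
  show ?case
  proof (cases "n = 0")
    case True
    have "parts_of 0 = {{#}}"
      by (auto simp: parts_of_def sum_mset_0_iff) (metis multiset_nonemptyE)
    moreover have "fps_nth (hsym_fps xs) 0 = 1"
      by (induction xs) (simp_all add: hsym_fps_def)
    ultimately show ?thesis using True by (simp add: hsym_def pprod_def zmult_def)
  next
    case False
    have "of_nat n * (\<Sum>M\<in>parts_of n. pprod M xs / of_nat (zmult M)) =
        (\<Sum>M\<in>parts_of n. \<Sum>j\<in>set_mset M.
           psum xs j * (pprod (M - {#j#}) xs / of_nat (zmult (M - {#j#}))))"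
      unfolding sum_distrib_left
    proof (rule sum.cong)
      fix M assume M: "M \<in> parts_of n"
      have "of_nat n = (of_nat (\<Sum>j\<in>#M. j) :: 'a)" using M by (simp add: parts_of_def)
      also have "\<dots> = (\<Sum>j\<in>set_mset M. of_nat (count M j * j))"
        by (subst sum_mset_eq_sum_count) simp
      finally have "of_nat n * (pprod M xs / of_nat (zmult M)) =
          (\<Sum>j\<in>set_mset M. of_nat (count M j * j) * (pprod M xs / of_nat (zmult M)))"
        by (simp only: sum_distrib_right)
      also have "\<dots> = (\<Sum>j\<in>set_mset M. psum xs j * (pprod (M - {#j#}) xs / of_nat (zmult (M - {#j#}))))"
      proof (rule sum.cong)
        fix j assume "j \<in> set_mset M"
        then obtain R where R: "M = add_mset j R" by (auto dest: multi_member_split)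
        have "j \<noteq> 0" "zmult R \<noteq> 0" using M zmult_pos[of R] by (auto simp: R parts_of_def)
        define K :: 'a where "K = of_nat (count M j * j)"
        have K: "K \<noteq> 0" using \<open>j \<noteq> 0\<close> unfolding K_def of_nat_eq_0_iff by (simp add: R)
        have zM: "of_nat (zmult M) = K * of_nat (zmult R)"
          unfolding K_def of_nat_mult[symmetric] by (simp add: R zmult_add_mset mult_ac)
        have "psum xs j * pprod R xs = pprod M xs" by (simp add: R pprod_def)
        with K show "of_nat (count M j * j) * (pprod M xs / of_nat (zmult M)) =
            psum xs j * (pprod (M - {#j#}) xs / of_nat (zmult (M - {#j#})))"
          unfolding zM K_def[symmetric] by (simp add: R)
      qed simp
      finally show "of_nat n * (pprod M xs / of_nat (zmult M)) = \<dots>" .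
    qed simp
    also have "\<dots> = (\<Sum>j=1..n. \<Sum>R\<in>parts_of (n - j). psum xs j * (pprod R xs / of_nat (zmult R)))"
      by (rule sum_parts_of_remove)
    also have "\<dots> = (\<Sum>j=1..n. psum xs j * hsym xs (int (n - j)))"
      by (rule sum.cong) (simp_all add: less.IH sum_distrib_left del: of_nat_diff)
    also have "\<dots> = of_nat n * hsym xs (int n)" by (rule newton[symmetric])
    finally show ?thesis using False by simp
  qed
qed

section \<open>Existence and uniqueness of skew characters\<close>

text \<open>The coefficients of \<open>p\<^sub>\<nu> / z\<^sub>\<nu>\<close>, rather than those of \<open>p\<^sub>\<nu>\<close>, are required to be integers: these are the
values of characters.\<close>

definition int_char_expansion :: "nat \<Rightarrow> (complex list \<Rightarrow> complex) \<Rightarrow> bool" where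
  "int_char_expansion n F \<longleftrightarrow> (\<exists>\<chi> :: nat multiset \<Rightarrow> int. \<forall>xs.
     F xs = (\<Sum>M\<in>parts_of n. of_int (\<chi> M) * pprod M xs / of_nat (zmult M)))"

lemma int_char_expansion_hsym: "int_char_expansion n (\<lambda>xs. hsym xs (int n))"
  unfolding int_char_expansion_def
  by (rule exI[of _ "\<lambda>_. 1"]) (simp add: hsym_power_sum_expansion)

lemma int_char_expansion_0: "int_char_expansion n (\<lambda>_. 0)"
  unfolding int_char_expansion_def by (rule exI[of _ "\<lambda>_. 0"]) simp

lemma int_char_expansion_add:
  assumes "int_char_expansion n F" "int_char_expansion n G"
  shows "int_char_expansion n (\<lambda>xs. F xs + G xs)"
proof -
  obtain \<chi> \<chi>' where
    "\<And>xs. F xs = (\<Sum>M\<in>parts_of n. of_int (\<chi> M) * pprod M xs / of_nat (zmult M))"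
    "\<And>xs. G xs = (\<Sum>M\<in>parts_of n. of_int (\<chi>' M) * pprod M xs / of_nat (zmult M))"
    using assms unfolding int_char_expansion_def by blast
  then show ?thesis unfolding int_char_expansion_def
    by (intro exI[of _ "\<lambda>M. \<chi> M + \<chi>' M"]) (simp add: sum.distrib[symmetric] distrib_right add_divide_distrib)
qed

lemma int_char_expansion_scale:
  assumes "int_char_expansion n F"
  shows "int_char_expansion n (\<lambda>xs. of_int c * F xs)"
proof -
  obtain \<chi> where
    "\<And>xs. F xs = (\<Sum>M\<in>parts_of n. of_int (\<chi> M) * pprod M xs / of_nat (zmult M))"
    using assms unfolding int_char_expansion_def by blast
  then show ?thesis unfolding int_char_expansion_def
    by (intro exI[of _ "\<lambda>M. c * \<chi> M"]) (simp add: sum_distrib_left mult_ac)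
qed

text \<open>Products of terms merge their parts, and \<open>zmult_union\<close> supplies the integral factor.\<close>

lemma int_char_expansion_mult:
  assumes "int_char_expansion m F" "int_char_expansion n G"
  shows "int_char_expansion (m + n) (\<lambda>xs. F xs * G xs)"
proof -
  obtain \<chi> \<chi>' where
    F: "\<And>xs. F xs = (\<Sum>M\<in>parts_of m. of_int (\<chi> M) * pprod M xs / of_nat (zmult M))" and
    G: "\<And>xs. G xs = (\<Sum>M\<in>parts_of n. of_int (\<chi>' M) * pprod M xs / of_nat (zmult M))"
    using assms unfolding int_char_expansion_def by blast
  obtain b where b: "\<And>A B. zmult (A + B) = zmult A * zmult B * b A B"
    using zmult_union by metis
  define P where "P = parts_of m \<times> parts_of n"
  define h where "h = (\<lambda>(A, B). \<chi> A * \<chi>' B * int (b A B))"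
  define \<psi> where "\<psi> K = (\<Sum>p\<in>{p\<in>P. fst p + snd p = K}. h p)" for K
  have summand: "(of_int (\<chi> A) * pprod A xs / of_nat (zmult A)) * (of_int (\<chi>' B) * pprod B xs / of_nat (zmult B)) =
      of_int (h (A, B)) * pprod (A + B) xs / of_nat (zmult (A + B))"
    if "A \<in> parts_of m" "B \<in> parts_of n" for A B and xs :: "complex list"
  proof -
    have "zmult (A + B) > 0" using that by (intro zmult_pos) (auto simp: parts_of_def)
    then have "zmult A \<noteq> 0" "zmult B \<noteq> 0" "b A B \<noteq> 0" by (auto simp: b)
    then show ?thesis by (simp add: b h_def pprod_def divide_simps)
  qed
  have "F xs * G xs = (\<Sum>K\<in>parts_of (m + n). of_int (\<psi> K) * pprod K xs / of_nat (zmult K))" for xs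
  proof -
    define w :: "nat multiset \<Rightarrow> complex" where "w K = pprod K xs / of_nat (zmult K)" for K
    have "F xs * G xs = (\<Sum>p\<in>P. of_int (h p) * w (fst p + snd p))"
      unfolding F G sum_product sum.cartesian_product P_def
    proof (rule sum.cong)
      fix p assume "p \<in> parts_of m \<times> parts_of n"
      then show "(case p of (A, B) \<Rightarrow> (of_int (\<chi> A) * pprod A xs / of_nat (zmult A)) *
          (of_int (\<chi>' B) * pprod B xs / of_nat (zmult B))) = of_int (h p) * w (fst p + snd p)"
        using summand[of "fst p" "snd p" xs]
        by (simp only: mem_Times_iff prod.collapse case_prod_beta w_def times_divide_eq_right simp_thms)
    qed simp
    also have "\<dots> = (\<Sum>K\<in>parts_of (m + n). \<Sum>p\<in>{p\<in>P. fst p + snd p = K}. of_int (h p) * w (fst p + snd p))"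
      by (rule sum.group[symmetric]) (auto simp: P_def finite_parts_of, auto simp: parts_of_def)
    also have "\<dots> = (\<Sum>K\<in>parts_of (m + n). of_int (\<psi> K) * w K)"
      by (rule sum.cong) (auto simp: \<psi>_def sum_distrib_right)
    finally show ?thesis by (simp add: w_def)
  qed
  then show ?thesis unfolding int_char_expansion_def by blast
qed

lemma int_char_expansion_1: "int_char_expansion 0 (\<lambda>_. 1)"
proof -
  have "hsym xs (int 0) = 1" for xs :: "complex list"
    by (induction xs) (simp_all add: hsym_def hsym_fps_def)
  then show ?thesis using int_char_expansion_hsym[of 0] by (simp only:)
qed

lemma int_char_expansion_sum:
  "finite I \<Longrightarrow> (\<And>i. i \<in> I \<Longrightarrow> int_char_expansion n (F i)) \<Longrightarrow>
     int_char_expansion n (\<lambda>xs. \<Sum>i\<in>I. F i xs)"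
  by (induction I rule: finite_induct) (auto intro: int_char_expansion_0 int_char_expansion_add)

lemma int_char_expansion_prod:
  "finite I \<Longrightarrow> (\<And>i. i \<in> I \<Longrightarrow> int_char_expansion (n i) (F i)) \<Longrightarrow>
     int_char_expansion (\<Sum>i\<in>I. n i) (\<lambda>xs. \<Prod>i\<in>I. F i xs)"
  by (induction I rule: finite_induct) (auto intro: int_char_expansion_1 int_char_expansion_mult)

text \<open>Every term of the Leibniz formula is, up to sign, a product of complete symmetric polynomials whose
degrees add up to \<open>n\<close>, or it contains a factor of negative degree and vanishes.\<close>

lemma int_char_expansion_jacobi_trudi:
  assumes "(\<Sum>i<r. f i) = (\<Sum>i<r. g i) + n"
  shows "int_char_expansion n (jacobi_trudi r f g)"
proof -
  define e where "e p i = (int (f i) - int i) - (int (g (p i)) - int (p i))" for p i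
  have "int_char_expansion n (\<lambda>xs. \<Prod>i<r. hsym xs (e p i))" if p: "p permutes {..<r}" for p
  proof (cases "\<forall>i<r. e p i \<ge> 0")
    case True
    have "(\<Sum>i<r. e p i) = (\<Sum>i<r. int (f i) - int i) - (\<Sum>i<r. int (g (p i)) - int (p i))"
      by (simp add: e_def sum_subtractf)
    also have "(\<Sum>i<r. int (g (p i)) - int (p i)) = (\<Sum>i<r. int (g i) - int i)"
      using sum.permute[OF p, of "\<lambda>i. int (g i) - int i"] by (simp add: o_def)
    also have "(\<Sum>i<r. int (f i) - int i) - \<dots> = int n"
      using assms by (simp add: sum_subtractf flip: of_nat_sum)
    finally have "(\<Sum>i<r. e p i) = int n" .
    moreover have "(\<Sum>i<r. e p i) = (\<Sum>i<r. int (nat (e p i)))" using True by (intro sum.cong) auto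
    ultimately have n: "(\<Sum>i<r. nat (e p i)) = n" by (simp only: of_nat_sum[symmetric] of_nat_eq_iff)
    have "int_char_expansion (\<Sum>i<r. nat (e p i)) (\<lambda>xs. \<Prod>i<r. hsym xs (int (nat (e p i))))"
      by (intro int_char_expansion_prod int_char_expansion_hsym) simp
    moreover have "(\<Prod>i<r. hsym xs (int (nat (e p i)))) = (\<Prod>i<r. hsym xs (e p i))" for xs :: "complex list"
      using True by (intro prod.cong) auto
    ultimately show ?thesis by (simp add: n)
  next
    case False
    then obtain i where "i < r" "e p i < 0" by (auto simp: not_le)
    then have "(\<Prod>i<r. hsym xs (e p i)) = 0" for xs :: "complex list"
      by (intro prod_zero) (auto intro!: bexI[of _ i])
    then show ?thesis by (simp only: int_char_expansion_0)
  qed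
  then have "int_char_expansion n (\<lambda>xs. \<Sum>p | p permutes {..<r}.
      of_int (sign p) * (\<Prod>i<r. hsym xs (e p i)))"
    by (intro int_char_expansion_sum int_char_expansion_scale) (auto simp: finite_permutations)
  then show ?thesis by (simp add: jacobi_trudi_def det_mat e_def[symmetric] int_char_expansion_def)
qed

text \<open>The product rule for the derivative at \<open>0\<close>.\<close>

lemma coeff_1_prod_linear:
  "coeff (\<Prod>k\<in>#M. [:a k, b k:]) 0 = (\<Prod>k\<in>#M. a k)"
  "coeff (\<Prod>k\<in>#M. [:a k, b k:]) 1 = (\<Sum>j\<in>#M. b j * (\<Prod>k\<in>#M - {#j#}. a k :: 'a::comm_ring_1))"
proof -
  show 0: "coeff (\<Prod>k\<in>#M. [:a k, b k:]) 0 = (\<Prod>k\<in>#M. a k)" for M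
    by (induction M) (simp_all add: coeff_mult)
  show "coeff (\<Prod>k\<in>#M. [:a k, b k:]) 1 = (\<Sum>j\<in>#M. b j * (\<Prod>k\<in>#M - {#j#}. a k))"
  proof (induction M)
    case (add x M)
    have "(\<Sum>j\<in>#M. b j * (\<Prod>k\<in>#add_mset x M - {#j#}. a k)) =
        (\<Sum>j\<in>#M. a x * (b j * (\<Prod>k\<in>#M - {#j#}. a k)))"
      by (intro arg_cong[where f = sum_mset] image_mset_cong)
        (simp add: add_mset_diff_bothsides diff_add_mset_swap mult_ac)
    also have "\<dots> = a x * (\<Sum>j\<in>#M. b j * (\<Prod>k\<in>#M - {#j#}. a k))"
      by (simp add: sum_mset_distrib_left image_mset.compositionality o_def)
    finally show ?case using add 0[of M] by (simp add: coeff_mult add.commute)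
  qed simp
qed

lemma poly_zero_if_vanishes_on_nats:
  fixes p :: "'a::field_char_0 poly"
  assumes "\<And>t. poly p (of_nat t) = 0"
  shows "p = 0"
proof (rule ccontr)
  assume "p \<noteq> 0"
  then have "finite {x. poly p x = 0}" by (rule poly_roots_finite)
  moreover have "range of_nat \<subseteq> {x. poly p x = 0}" using assms by auto
  ultimately have "finite (range (of_nat :: nat \<Rightarrow> 'a))" by (rule finite_subset[rotated])
  then have "finite (UNIV :: nat set)" by (rule finite_imageD) (simp add: inj_on_def)
  then show False by simp
qed

text \<open>Appending \<open>t\<close> copies of a variable \<open>s\<close> replaces \<open>p\<^sub>k\<close> by \<open>p\<^sub>k + t s\<^sup>k\<close>. The relation is then a polynomial in \<open>t\<close>
that vanishes at all natural numbers, so its coefficient at \<open>t\<close> is zero; that coefficient is a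
polynomial in \<open>s\<close>, and its coefficient at \<open>s\<^sup>j\<close> is the derivative of the relation by \<open>p\<^sub>j\<close>, a relation of
smaller weight. Induction on the weight shows that all derivatives have zero coefficients.\<close>

theorem power_sums_independent:
  fixes c :: "nat multiset \<Rightarrow> 'a::field_char_0"
  assumes "\<And>xs. (\<Sum>M\<in>parts_of n. c M * pprod M xs) = 0"
  shows "\<forall>M\<in>parts_of n. c M = 0"
  using assms
proof (induction n arbitrary: c rule: less_induct)
  case (less n)
  have derivative: "(\<Sum>j=1..n. s ^ j * (\<Sum>R\<in>parts_of (n - j).
      (of_nat (Suc (count R j)) * c (add_mset j R)) * pprod R xs)) = 0" for s xs
  proof -
    define Q where "Q M = (\<Prod>k\<in>#M. [:psum xs k, s ^ k:])" for M
    have "poly (\<Sum>M\<in>parts_of n. smult (c M) (Q M)) (of_nat t) = 0" for t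
    proof -
      have "psum (xs @ replicate t s) k = poly [:psum xs k, s ^ k:] (of_nat t)" for k
        by (simp add: psum_def sum_list_replicate)
      then have "pprod M (xs @ replicate t s) = poly (Q M) (of_nat t)" for M
        by (induction M) (simp_all add: pprod_def Q_def algebra_simps)
      then show ?thesis using less.prems[of "xs @ replicate t s"] by (simp add: poly_sum)
    qed
    then have "(\<Sum>M\<in>parts_of n. smult (c M) (Q M)) = 0" by (rule poly_zero_if_vanishes_on_nats)
    then have "0 = coeff (\<Sum>M\<in>parts_of n. smult (c M) (Q M)) 1" by simp
    also have "\<dots> = (\<Sum>M\<in>parts_of n. c M * coeff (Q M) 1)" by (simp add: coeff_sum)
    also have "\<dots> = (\<Sum>M\<in>parts_of n. \<Sum>j\<in>set_mset M. s ^ j *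
        (of_nat (Suc (count (M - {#j#}) j)) * c (add_mset j (M - {#j#})) * pprod (M - {#j#}) xs))"
      unfolding Q_def coeff_1_prod_linear sum_mset_eq_sum_count sum_distrib_left
      by (intro sum.cong) (auto simp: pprod_def Suc_diff_1 count_greater_zero_iff simp del: of_nat_Suc)
    also have "\<dots> = (\<Sum>j=1..n. \<Sum>R\<in>parts_of (n - j). s ^ j *
        (of_nat (Suc (count R j)) * c (add_mset j R) * pprod R xs))"
      by (rule sum_parts_of_remove)
    finally show ?thesis by (simp add: sum_distrib_left)
  qed
  have "(\<Sum>R\<in>parts_of (n - j). (of_nat (Suc (count R j)) * c (add_mset j R)) * pprod R xs) = 0"
    if j: "1 \<le> j" "j \<le> n" for j xs
  proof -
    define d where "d j = (\<Sum>R\<in>parts_of (n - j). (of_nat (Suc (count R j)) * c (add_mset j R)) * pprod R xs)" for j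
    have "poly (\<Sum>j=1..n. monom (d j) j) (of_nat s) = 0" for s
      using derivative[of "of_nat s" xs] unfolding poly_sum poly_monom d_def
      by (simp only: mult.commute)
    then have "(\<Sum>j=1..n. monom (d j) j) = 0" by (rule poly_zero_if_vanishes_on_nats)
    then have "0 = coeff (\<Sum>j=1..n. monom (d j) j) j" by simp
    also have "\<dots> = d j" using j by (simp add: coeff_sum)
    finally show ?thesis by (simp add: d_def)
  qed
  then have step: "\<forall>R\<in>parts_of (n - j). of_nat (Suc (count R j)) * c (add_mset j R) = 0"
    if "1 \<le> j" "j \<le> n" for j
    using that by (intro less.IH) auto
  show ?case
  proof
    fix M assume M: "M \<in> parts_of n"
    show "c M = 0"
    proof (cases "M = {#}")
      case True
      then have "n = 0" using M by (simp add: parts_of_def)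
      have "parts_of 0 = {{#}}"
        by (auto simp: parts_of_def sum_mset_0_iff) (metis multiset_nonemptyE)
      then show ?thesis using less.prems[of "[]"] True \<open>n = 0\<close> by (simp add: pprod_def)
    next
      case False
      then obtain j R where R: "M = add_mset j R" by (meson multiset_cases)
      then have "1 \<le> j" "j \<le> n" "R \<in> parts_of (n - j)" using M by (auto simp: parts_of_def Suc_le_eq)
      then have "of_nat (Suc (count R j)) * c M = 0" using step[of j] R by blast
      then show ?thesis by (simp only: mult_eq_0_iff of_nat_eq_0_iff) simp
    qed
  qed
qed

lemma bij_betw_partitions_of: "bij_betw mset (partitions_of n) (parts_of n)"
proof (rule bij_betw_imageI)
  show "inj_on mset (partitions_of n)"
  proof (rule inj_onI)
    fix xs ys assume *: "xs \<in> partitions_of n" "ys \<in> partitions_of n" "mset xs = mset ys"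
    then have "sorted (rev xs)" "sorted (rev ys)"
      by (auto simp: partitions_of_def is_partition_def sorted_wrt_rev)
    then have "rev xs = rev ys" using *(3) by (metis mset_rev properties_for_sort)
    then show "xs = ys" by simp
  qed
  show "mset ` partitions_of n = parts_of n"
  proof (intro equalityI subsetI)
    fix M assume M: "M \<in> parts_of n"
    define xs where "xs = rev (sorted_list_of_multiset M)"
    have xs: "mset xs = M" by (simp add: xs_def)
    have "sorted_wrt (\<ge>) xs" by (simp add: xs_def sorted_wrt_rev)
    moreover have "0 \<notin> set xs" "sum_list xs = n"
      using M xs by (auto simp: parts_of_def sum_mset_sum_list[symmetric])
    ultimately have "xs \<in> partitions_of n" by (simp add: partitions_of_def is_partition_def)
    then show "M \<in> mset ` partitions_of n" using xs by blast
  qed (auto simp: partitions_of_def is_partition_def parts_of_def sum_mset_sum_list)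
qed

lemma power_sum_eq_pprod: "power_sum \<nu> xs = pprod (mset \<nu>) xs"
proof -
  have "power_sum \<nu> xs = prod_list (map (psum xs) \<nu>)" by (simp add: power_sum_def psum_def[abs_def])
  also have "\<dots> = pprod (mset \<nu>) xs" by (induction \<nu>) (simp_all add: pprod_def)
  finally show ?thesis .
qed

lemma z_num_eq_zmult: "z_num \<nu> = zmult (mset \<nu>)"
  by (simp add: z_num_def zmult_def count_mset)

lemma sum_partitions_of:
  "(\<Sum>\<nu>\<in>partitions_of n. f (mset \<nu>)) = (\<Sum>M\<in>parts_of n. f M)"
  using sum.reindex_bij_betw[OF bij_betw_partitions_of] .

text \<open>Turns the definite description of the character into usable facts: an integral expansion exists by
assumption, and the independence of power sums makes it the only one.\<close>

lemma skew_char_expansion: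
  fixes lam mu :: "nat list"
  assumes "int_char_expansion (skew_size lam mu) (skew_schur lam mu)"
  obtains \<chi> :: "nat multiset \<Rightarrow> int" where
    "\<And>xs :: complex list. skew_schur lam mu xs =
       (\<Sum>M\<in>parts_of (skew_size lam mu). of_int (\<chi> M) * pprod M xs / of_nat (zmult M))"
    "\<And>\<nu>. \<nu> \<in> partitions_of (skew_size lam mu) \<Longrightarrow> skew_char lam mu \<nu> = \<chi> (mset \<nu>)"
proof -
  define n where "n = skew_size lam mu"
  define Q :: "(nat list \<Rightarrow> int) \<Rightarrow> bool" where "Q \<chi> \<longleftrightarrow> (\<forall>\<nu>. \<nu> \<notin> partitions_of n \<longrightarrow> \<chi> \<nu> = 0) \<and>
     (\<forall>xs :: complex list. skew_schur lam mu xs =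
        (\<Sum>\<nu>\<in>partitions_of n. of_int (\<chi> \<nu>) * power_sum \<nu> xs / of_nat (z_num \<nu>)))" for \<chi>
  obtain \<chi> :: "nat multiset \<Rightarrow> int" where \<chi>: "\<And>xs :: complex list. skew_schur lam mu xs =
       (\<Sum>M\<in>parts_of n. of_int (\<chi> M) * pprod M xs / of_nat (zmult M))"
    using assms unfolding int_char_expansion_def n_def by blast
  define \<chi>' where "\<chi>' \<nu> = (if \<nu> \<in> partitions_of n then \<chi> (mset \<nu>) else 0)" for \<nu>
  have Q: "Q \<chi>'" unfolding Q_def
  proof (intro conjI allI impI)
    fix xs :: "complex list"
    have "skew_schur lam mu xs = (\<Sum>\<nu>\<in>partitions_of n.
        of_int (\<chi> (mset \<nu>)) * pprod (mset \<nu>) xs / of_nat (zmult (mset \<nu>)))"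
      unfolding \<chi> by (rule sum_partitions_of[symmetric])
    also have "\<dots> = (\<Sum>\<nu>\<in>partitions_of n. of_int (\<chi>' \<nu>) * power_sum \<nu> xs / of_nat (z_num \<nu>))"
      by (rule sum.cong) (simp_all add: \<chi>'_def power_sum_eq_pprod z_num_eq_zmult)
    finally show "skew_schur lam mu xs = \<dots>" .
  qed (simp add: \<chi>'_def)
  have "\<psi> = \<chi>'" if \<psi>: "Q \<psi>" for \<psi>
  proof -
    define g where "g = the_inv_into (partitions_of n) mset"
    have g: "g (mset \<nu>) = \<nu>" if "\<nu> \<in> partitions_of n" for \<nu>
      unfolding g_def using bij_betw_partitions_of[of n] that
      by (intro the_inv_into_f_f) (auto simp: bij_betw_def)
    define c :: "nat multiset \<Rightarrow> complex" where
      "c M = of_int (\<psi> (g M) - \<chi>' (g M)) / of_nat (zmult M)" for M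
    have "(\<Sum>M\<in>parts_of n. c M * pprod M xs) = 0" for xs
    proof -
      have "(\<Sum>M\<in>parts_of n. c M * pprod M xs) = (\<Sum>\<nu>\<in>partitions_of n. c (mset \<nu>) * pprod (mset \<nu>) xs)"
        by (rule sum_partitions_of[symmetric])
      also have "\<dots> = (\<Sum>\<nu>\<in>partitions_of n. of_int (\<psi> \<nu>) * power_sum \<nu> xs / of_nat (z_num \<nu>) -
          of_int (\<chi>' \<nu>) * power_sum \<nu> xs / of_nat (z_num \<nu>))"
        by (rule sum.cong)
          (simp_all add: c_def g power_sum_eq_pprod z_num_eq_zmult left_diff_distrib diff_divide_distrib)
      also have "\<dots> = skew_schur lam mu xs - skew_schur lam mu xs"
        using Q \<psi> unfolding Q_def sum_subtractf by metis
      finally show ?thesis by simp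
    qed
    then have c: "\<forall>M\<in>parts_of n. c M = 0" by (rule power_sums_independent)
    show ?thesis
    proof
      fix \<nu> show "\<psi> \<nu> = \<chi>' \<nu>"
      proof (cases "\<nu> \<in> partitions_of n")
        case True
        then have M: "mset \<nu> \<in> parts_of n" using bij_betwE[OF bij_betw_partitions_of] by blast
        then have "zmult (mset \<nu>) > 0" by (intro zmult_pos) (simp add: parts_of_def)
        moreover have "c (mset \<nu>) = 0" using c M by blast
        ultimately have "(of_int (\<psi> \<nu> - \<chi>' \<nu>) :: complex) = 0"
          unfolding c_def g[OF True] by simp
        then have "\<psi> \<nu> - \<chi>' \<nu> = 0" unfolding of_int_eq_0_iff .
        then show ?thesis by simp
      qed (use Q \<psi> in \<open>simp add: Q_def\<close>)
    qed
  qed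
  then have "(THE \<chi>. Q \<chi>) = \<chi>'" using Q by (intro the_equality)
  moreover have "skew_char lam mu = (THE \<chi>. Q \<chi>)" by (simp add: skew_char_def Q_def n_def)
  ultimately have "skew_char lam mu = \<chi>'" by simp
  then show ?thesis using that[of \<chi>] \<chi> by (simp add: \<chi>'_def n_def)
qed

section \<open>Specialisation at roots of unity\<close>

lemma primitive_root_power_eq_1_iff:
  assumes "primitive_root_of_unity d \<omega>" "d > 0"
  shows "\<omega> ^ k = 1 \<longleftrightarrow> d dvd k"
proof -
  have "\<omega> ^ k = \<omega> ^ (d * (k div d) + k mod d)" by simp
  also have "\<dots> = \<omega> ^ (k mod d)"
    using assms(1) unfolding power_add power_mult by (simp add: primitive_root_of_unity_def)
  finally show ?thesis
    using assms mod_less_divisor[of d k] by (auto simp: primitive_root_of_unity_def dvd_eq_mod_eq_0)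
qed

lemma psum_roots_of_unity:
  assumes "primitive_root_of_unity d \<omega>" "d > 0" "d dvd N"
  shows "psum (map (\<lambda>k. \<omega> ^ k) [0..<N]) k = (if d dvd k then of_nat N else 0)"
proof -
  have *: "psum (map (\<lambda>k. \<omega> ^ k) [0..<N]) k = (\<Sum>j<N. (\<omega> ^ k) ^ j)"
    by (simp add: psum_def o_def sum_list_sum_nth atLeast0LessThan power_commutes flip: power_mult)
      (simp add: mult.commute)
  show ?thesis
  proof (cases "d dvd k")
    case True
    then have "\<omega> ^ k = 1" using primitive_root_power_eq_1_iff assms by blast
    then show ?thesis using True unfolding * by simp
  next
    case False
    then have "\<omega> ^ k \<noteq> 1" using primitive_root_power_eq_1_iff assms by blast
    moreover have "(\<omega> ^ k) ^ N = 1"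
      using primitive_root_power_eq_1_iff[of d \<omega> "k * N"] assms by (simp add: power_mult)
    ultimately show ?thesis using False unfolding * by (simp add: geometric_sum)
  qed
qed

lemma psum_replicate_1: "psum (replicate M 1) k = of_nat M"
  by (simp add: psum_def sum_list_replicate)

lemma hsym_0: "hsym xs 0 = 1"
  by (induction xs) (simp_all add: hsym_def hsym_fps_def)

text \<open>Newton's recursion with \<open>p\<^sub>k = d M\<close> for \<open>d dvd k\<close> and \<open>p\<^sub>k = 0\<close> otherwise never leaves a residue class
modulo \<open>d\<close>; on the multiples of \<open>d\<close> it is \<open>d\<close> times the recursion for \<open>M\<close> ones.\<close>

theorem hsym_roots_of_unity:
  assumes \<omega>: "primitive_root_of_unity d \<omega>" and d: "d > 0"
  shows "hsym (map (\<lambda>k. \<omega> ^ k) [0..<d * M]) (int n) =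
    (if d dvd n then hsym (replicate M 1) (int (n div d)) else 0)"
proof (induction n rule: less_induct)
  case (less n)
  define h where "h n = hsym (map (\<lambda>k. \<omega> ^ k) [0..<d * M]) (int n)" for n
  define h' :: "nat \<Rightarrow> complex" where "h' n = hsym (replicate M 1) (int n)" for n
  have IH: "h k = (if d dvd k then h' (k div d) else 0)" if "k < n" for k
    using less.IH[OF that] by (simp only: h_def h'_def)
  have "h n = (if d dvd n then h' (n div d) else 0)"
  proof (cases "n = 0")
    case True
    then show ?thesis by (simp add: h_def h'_def hsym_0)
  next
    case False
    have "of_nat n * h n = (\<Sum>k=1..n. (if d dvd k then of_nat (d * M) else 0) * h (n - k))"
      unfolding h_def newton psum_roots_of_unity[OF \<omega> d dvd_triv_left] ..
    also have "\<dots> = (if d dvd n then of_nat n * h' (n div d) else 0)"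
    proof (cases "d dvd n")
      case True
      then obtain q where q: "n = d * q" by blast
      have "(\<Sum>k=1..n. (if d dvd k then of_nat (d * M) else 0) * h (n - k)) =
          (\<Sum>k\<in>(\<lambda>l. d * l) ` {1..q}. of_nat (d * M) * h (n - k))"
        by (rule sum.mono_neutral_cong_right) (use d in \<open>auto simp: q\<close>)
      also have "\<dots> = (\<Sum>l=1..q. of_nat (d * M) * h (n - d * l))"
        by (rule sum.reindex_cong[OF _ refl]) (use d in \<open>auto simp: inj_on_def\<close>)
      also have "\<dots> = (\<Sum>l=1..q. of_nat d * (of_nat M * h' (q - l)))"
      proof (rule sum.cong)
        fix l assume l: "l \<in> {1..q}"
        have "n - d * l = d * (q - l)" by (simp add: q diff_mult_distrib2)
        moreover have "n - d * l < n" using l d False by simp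
        ultimately show "of_nat (d * M) * h (n - d * l) = of_nat d * (of_nat M * h' (q - l))"
          using IH[of "n - d * l"] d by simp
      qed simp
      also have "\<dots> = of_nat d * (\<Sum>l=1..q. psum (replicate M 1) l * h' (q - l))"
        by (simp only: sum_distrib_left psum_replicate_1)
      also have "\<dots> = of_nat d * (of_nat q * h' q)"
        unfolding h'_def newton ..
      finally show ?thesis using True d by (simp add: q)
    next
      case False
      then show ?thesis by (intro trans[OF sum.neutral]) (auto simp: IH dvd_diff_nat dest: dvd_diffD)
    qed
    finally show ?thesis using False by (cases "d dvd n") simp_all
  qed
  then show ?case by (simp only: h_def h'_def)
qed

section \<open>Determinants indexed by two lists\<close>

text \<open>Rows and columns are labelled by the elements of two lists, so that reordering and cutting the lists
reorders and cuts the matrix.\<close>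

definition pair_det :: "('b \<Rightarrow> 'c \<Rightarrow> 'a::comm_ring_1) \<Rightarrow> 'b list \<Rightarrow> 'c list \<Rightarrow> 'a" where
  "pair_det g as bs = det (mat (length as) (length as) (\<lambda>(i, j). g (as ! i) (bs ! j)))"

lemma pair_det_swap:
  assumes "length as = length bs"
  shows "pair_det g as bs = pair_det (\<lambda>b a. g a b) bs as"
proof -
  have "mat (length as) (length as) (\<lambda>(i, j). g (as ! i) (bs ! j)) =
      transpose_mat (mat (length bs) (length bs) (\<lambda>(i, j). g (as ! j) (bs ! i)))"
    using assms by (intro eq_matI) auto
  then show ?thesis unfolding pair_det_def by (simp add: det_transpose[OF mat_carrier])
qed

lemma pair_det_permute_rows:
  assumes "mset as' = mset as"
  obtains \<epsilon> :: int where "\<epsilon> = 1 \<or> \<epsilon> = -1"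
    "\<And>g bs. length bs = length as \<Longrightarrow> pair_det g as' bs = of_int \<epsilon> * (pair_det g as bs :: 'a::comm_ring_1)"
proof -
  from mset_eq_permutation[OF assms] obtain p where
    p: "p permutes {..<length as}" and as': "permute_list p as = as'" by blast
  have "pair_det g as' bs = of_int (sign p) * (pair_det g as bs :: 'a)" if "length bs = length as" for g bs
  proof -
    define n where "n = length as"
    define A where "A = mat n n (\<lambda>(i, j). g (as ! i) (bs ! j))"
    have p': "p permutes {0..<n}" using p by (simp add: n_def atLeast0LessThan)
    have "mat n n (\<lambda>(i, j). A $$ (p i, j)) = mat n n (\<lambda>(i, j). g (as' ! i) (bs ! j))"
      using permutes_in_image[OF p] p
      by (intro eq_matI) (auto simp: A_def n_def as'[symmetric] permute_list_nth)
    then have "det (mat n n (\<lambda>(i, j). g (as' ! i) (bs ! j))) = of_int (sign p) * det A"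
      using det_permute_rows[of A n p] p' by (simp add: A_def)
    then show ?thesis using as' by (auto simp: pair_det_def A_def n_def)
  qed
  moreover have "sign p = 1 \<or> sign p = (-1 :: int)" by (simp add: sign_def)
  ultimately show ?thesis using that by blast
qed

text \<open>The sign depends on the two rearrangements only and serves all entry functions \<open>g\<close> at once.\<close>

lemma pair_det_permute:
  fixes as as' :: "'b list" and bs bs' :: "'c list"
  assumes "mset as' = mset as" "mset bs' = mset bs" "length as = length bs"
  obtains \<epsilon> :: int where "\<epsilon> = 1 \<or> \<epsilon> = -1"
    "\<And>g. pair_det g as' bs' = of_int \<epsilon> * (pair_det g as bs :: 'a::comm_ring_1)"
proof -
  have len: "length as' = length as" "length bs' = length bs"
    using assms by (metis size_mset)+
  obtain \<epsilon>1 :: int where \<epsilon>1: "\<epsilon>1 = 1 \<or> \<epsilon>1 = -1" and rows: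
    "\<And>g (bs :: 'c list). length bs = length as \<Longrightarrow> pair_det g as' bs = of_int \<epsilon>1 * (pair_det g as bs :: 'a)"
    by (rule pair_det_permute_rows[OF assms(1), where ?'a = 'a and ?'c = 'c]) (rule that)
  obtain \<epsilon>2 :: int where \<epsilon>2: "\<epsilon>2 = 1 \<or> \<epsilon>2 = -1" and cols:
    "\<And>g (as :: 'b list). length as = length bs \<Longrightarrow> pair_det g bs' as = of_int \<epsilon>2 * (pair_det g bs as :: 'a)"
    by (rule pair_det_permute_rows[OF assms(2), where ?'a = 'a and ?'c = 'b]) (rule that)
  have "pair_det g as' bs' = of_int (\<epsilon>1 * \<epsilon>2) * (pair_det g as bs :: 'a)" for g
  proof -
    have "pair_det g as' bs' = of_int \<epsilon>1 * pair_det g as bs'" by (rule rows) (simp add: len assms(3))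
    also have "pair_det g as bs' = pair_det (\<lambda>b a. g a b) bs' as"
      by (rule pair_det_swap) (simp add: len assms(3))
    also have "\<dots> = of_int \<epsilon>2 * pair_det (\<lambda>b a. g a b) bs as" by (rule cols) (rule assms(3))
    also have "pair_det (\<lambda>b a. g a b) bs as = pair_det g as bs"
      by (rule pair_det_swap[symmetric]) (rule assms(3))
    finally show ?thesis by (simp add: mult.assoc)
  qed
  moreover have "\<epsilon>1 * \<epsilon>2 = 1 \<or> \<epsilon>1 * \<epsilon>2 = -1" using \<epsilon>1 \<epsilon>2 by auto
  ultimately show ?thesis by (rule that[rotated])
qed

lemma pair_det_append:
  fixes g :: "'b \<Rightarrow> 'c \<Rightarrow> 'a::idom"
  assumes "length as1 = length bs1" "length as2 = length bs2"
    and "\<And>a b. a \<in> set as2 \<Longrightarrow> b \<in> set bs1 \<Longrightarrow> g a b = 0"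
  shows "pair_det g (as1 @ as2) (bs1 @ bs2) = pair_det g as1 bs1 * pair_det g as2 bs2"
proof -
  define m n where "m = length as1" and "n = length as2"
  define A1 where "A1 = mat m m (\<lambda>(i, j). g (as1 ! i) (bs1 ! j))"
  define A2 where "A2 = mat m n (\<lambda>(i, j). g (as1 ! i) (bs2 ! j))"
  define A4 where "A4 = mat n n (\<lambda>(i, j). g (as2 ! i) (bs2 ! j))"
  have "mat (m + n) (m + n) (\<lambda>(i, j). g ((as1 @ as2) ! i) ((bs1 @ bs2) ! j)) =
      four_block_mat A1 A2 (0\<^sub>m n m) A4"
    using assms by (intro eq_matI) (auto simp: A1_def A2_def A4_def m_def n_def nth_append)
  moreover have "det (four_block_mat A1 A2 (0\<^sub>m n m) A4) = det A1 * det A4"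
    by (rule det_four_block_mat_lower_left_zero) (auto simp: A1_def A2_def A4_def)
  ultimately show ?thesis by (simp add: pair_det_def A1_def A4_def m_def n_def)
qed

lemma pair_det_concat:
  fixes g :: "'b \<Rightarrow> 'c \<Rightarrow> 'a::idom"
  assumes "distinct I" "\<And>i. i \<in> set I \<Longrightarrow> length (A i) = length (B i)"
    and "\<And>i j a b. i \<in> set I \<Longrightarrow> j \<in> set I \<Longrightarrow> i \<noteq> j \<Longrightarrow> a \<in> set (A i) \<Longrightarrow> b \<in> set (B j) \<Longrightarrow> g a b = 0"
  shows "pair_det g (concat (map A I)) (concat (map B I)) = (\<Prod>i\<leftarrow>I. pair_det g (A i) (B i))"
  using assms
proof (induction I)
  case (Cons i I)
  have "length (concat (map A I)) = length (concat (map B I))"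
    unfolding length_concat map_map o_def using Cons.prems(2) by (intro arg_cong[where f = sum_list] map_cong) auto
  moreover have "g a b = 0" if "a \<in> set (concat (map A I))" "b \<in> set (B i)" for a b
    using that Cons.prems(1) Cons.prems(3)[of _ i a b] by auto
  ultimately have "pair_det g (A i @ concat (map A I)) (B i @ concat (map B I)) =
      pair_det g (A i) (B i) * pair_det g (concat (map A I)) (concat (map B I))"
    using Cons.prems(2) by (intro pair_det_append) auto
  also have "pair_det g (concat (map A I)) (concat (map B I)) = (\<Prod>i\<leftarrow>I. pair_det g (A i) (B i))"
    using Cons.prems(1,2) by (intro Cons.IH Cons.prems(3)) auto
  finally show ?case by simp
qed (simp add: pair_det_def)

text \<open>A nonvanishing term of the Leibniz formula would restrict to a bijection between the rows with
property \<open>P\<close> and the columns with property \<open>Q\<close>.\<close>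

lemma pair_det_eq_0_if_unbalanced:
  fixes g :: "'b \<Rightarrow> 'c \<Rightarrow> 'a::comm_ring_1"
  assumes len: "length as = length bs"
    and "\<And>a b. a \<in> set as \<Longrightarrow> b \<in> set bs \<Longrightarrow> P a \<noteq> Q b \<Longrightarrow> g a b = 0"
    and "length (filter P as) \<noteq> length (filter Q bs)"
  shows "pair_det g as bs = 0"
proof -
  define n where "n = length as"
  have "(\<Prod>i<n. g (as ! i) (bs ! p i)) = 0" if p: "p permutes {..<n}" for p
  proof -
    have "\<exists>i<n. P (as ! i) \<noteq> Q (bs ! p i)"
    proof (rule ccontr)
      assume "\<not> ?thesis"
      then have *: "P (as ! i) = Q (bs ! p i)" if "i < n" for i using that by blast
      have "p ` {i. i < n \<and> P (as ! i)} = {j. j < n \<and> Q (bs ! j)}"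
      proof (intro equalityI subsetI)
        fix j assume j: "j \<in> {j. j < n \<and> Q (bs ! j)}"
        then have "j \<in> p ` {..<n}" using permutes_image[OF p] by simp
        then show "j \<in> p ` {i. i < n \<and> P (as ! i)}" using * j by auto
      qed (use * permutes_in_image[OF p] in auto)
      then have "card {i. i < n \<and> P (as ! i)} = card {j. j < n \<and> Q (bs ! j)}"
        using card_image[of p "{i. i < n \<and> P (as ! i)}"] permutes_inj_on[OF p] by simp
      then show False using assms(3) len by (simp add: length_filter_conv_card n_def)
    qed
    then obtain i where i: "i < n" "P (as ! i) \<noteq> Q (bs ! p i)" by blast
    moreover have "p i < n" using permutes_in_image[OF p, of i] i by simp
    ultimately have "g (as ! i) (bs ! p i) = 0" using assms(2) len by (simp add: n_def)
    then show ?thesis using i by (intro prod_zero) auto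
  qed
  then show ?thesis by (simp add: pair_det_def det_mat n_def[symmetric])
qed

section \<open>Border strips as bead moves, and cores\<close>

lemma part_antimono: "is_partition \<kappa> \<Longrightarrow> i \<le> j \<Longrightarrow> part \<kappa> j \<le> part \<kappa> i"
  by (cases "i = j") (auto simp: Defs.part_def is_partition_def sorted_wrt_iff_nth_less)

lemma part_eq_0_iff: "is_partition \<kappa> \<Longrightarrow> part \<kappa> i = 0 \<longleftrightarrow> length \<kappa> \<le> i"
  using nth_mem[of i \<kappa>] by (cases "i < length \<kappa>") (auto simp: Defs.part_def is_partition_def simp del: nth_mem intro!: gr0I)

lemma partition_eqI:
  assumes "is_partition \<kappa>" "is_partition \<kappa>'" "\<And>i. part \<kappa> i = part \<kappa>' i"
  shows "\<kappa> = \<kappa>'"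
proof (rule nth_equalityI)
  have "length \<kappa> \<le> i \<longleftrightarrow> length \<kappa>' \<le> i" for i
    using part_eq_0_iff assms by metis
  then show len: "length \<kappa> = length \<kappa>'" by (meson le_antisym le_refl)
  show "\<kappa> ! i = \<kappa>' ! i" if "i < length \<kappa>" for i
    using assms(3)[of i] that len by (simp add: Defs.part_def)
qed

text \<open>In a weakly decreasing list the zeros form a final segment, so dropping them does not move the other
entries.\<close>

lemma part_filter_nonzero:
  "sorted_wrt (\<ge>) xs \<Longrightarrow> part (filter (\<lambda>k. k \<noteq> 0) xs) i = (if i < length xs then xs ! i else 0)"
proof (induction xs arbitrary: i)
  case (Cons x xs)
  show ?case
  proof (cases "x = 0")
    case True
    then have z: "y = 0" if "y \<in> set (x # xs)" for y using Cons.prems that by auto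
    then have "filter (\<lambda>k. k \<noteq> 0) (x # xs) = []" unfolding filter_empty_conv by blast
    then have "part (filter (\<lambda>k. k \<noteq> 0) (x # xs)) i = 0" by (simp only: Defs.part_def list.size not_less0 if_False)
    moreover have "(x # xs) ! i = 0" if "i < length (x # xs)" using z[OF nth_mem[OF that]] .
    ultimately show ?thesis by (cases "i < length (x # xs)") (simp_all only: if_True if_False)
  next
    case False
    show ?thesis
    proof (cases i)
      case (Suc n)
      then have "part (filter (\<lambda>k. k \<noteq> 0) (x # xs)) i = part (filter (\<lambda>k. k \<noteq> 0) xs) n"
        using False by (simp add: Defs.part_def)
      then show ?thesis using Cons.IH[of n] Cons.prems Suc by simp
    qed (use False in \<open>simp add: Defs.part_def\<close>)
  qed
qed (simp add: Defs.part_def)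

lemma is_partition_filter_nonzero:
  "sorted_wrt (\<ge>) xs \<Longrightarrow> is_partition (filter (\<lambda>k. k \<noteq> 0) xs)"
  by (simp add: is_partition_def sorted_wrt_filter)

lemma partition_of_function:
  fixes f :: "nat \<Rightarrow> nat"
  assumes "\<And>i. Suc i < r \<Longrightarrow> f (Suc i) \<le> f i"
  obtains \<kappa> where "is_partition \<kappa>" "length \<kappa> \<le> r" "\<And>i. part \<kappa> i = (if i < r then f i else 0)"
proof -
  have "f j \<le> f i" if "i \<le> j" "j < r" for i j
    using that by (induction j rule: dec_induct) (use assms in \<open>auto intro: le_trans\<close>)
  then have s: "sorted_wrt (\<ge>) (map f [0..<r])" by (simp add: sorted_wrt_iff_nth_less)
  show ?thesis
    by (rule that[OF is_partition_filter_nonzero[OF s]])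
      (use part_filter_nonzero[OF s] length_filter_le[of _ "map f [0..<r]"] in auto)
qed

definition bead_pos :: "nat \<Rightarrow> nat list \<Rightarrow> nat \<Rightarrow> nat" where
  "bead_pos r \<kappa> i = part \<kappa> i + (r - Suc i)"

lemma beads_eq_image: "beads r \<kappa> = bead_pos r \<kappa> ` {..<r}"
  unfolding beads_def bead_pos_def by blast

lemma finite_beads: "finite (beads r \<kappa>)"
  by (simp add: beads_eq_image)

lemma bead_pos_strict_dec:
  "is_partition \<kappa> \<Longrightarrow> i < j \<Longrightarrow> j < r \<Longrightarrow> bead_pos r \<kappa> j < bead_pos r \<kappa> i"
  using part_antimono[of \<kappa> i j] by (simp add: bead_pos_def)

lemma bead_pos_eq_iff:
  "is_partition \<kappa> \<Longrightarrow> i < r \<Longrightarrow> j < r \<Longrightarrow> bead_pos r \<kappa> i = bead_pos r \<kappa> j \<longleftrightarrow> i = j"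
  using bead_pos_strict_dec[of \<kappa> i j r] bead_pos_strict_dec[of \<kappa> j i r]
  by (cases i j rule: linorder_cases) auto

lemma beads_inject:
  assumes "is_partition \<kappa>" "is_partition \<kappa>'" "length \<kappa> \<le> r" "length \<kappa>' \<le> r"
    and "beads r \<kappa> = beads r \<kappa>'"
  shows "\<kappa> = \<kappa>'"
proof (rule partition_eqI[OF assms(1,2)])
  fix i
  have "\<forall>i<r. bead_pos r \<kappa> i = bead_pos r \<kappa>' i"
    by (rule strict_dec_determined_by_image)
      (use assms bead_pos_strict_dec in \<open>auto simp: beads_eq_image\<close>)
  then show "part \<kappa> i = part \<kappa>' i"
    using assms(3,4) by (cases "i < r") (auto simp: bead_pos_def Defs.part_def)
qed

lemma skew_size_eq_bead_sum:
  assumes "skew_partition lam mu" "length lam \<le> r"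
  shows "int (skew_size lam mu) = (\<Sum>i<r. int (bead_pos r lam i) - int (bead_pos r mu i))"
proof -
  have le: "part mu i \<le> part lam i" for i using assms by (simp add: skew_partition_def)
  have "int (skew_size lam mu) = (\<Sum>i<length lam. int (part lam i) - int (part mu i))"
    unfolding skew_size_def of_nat_sum by (rule sum.cong) (simp_all add: le of_nat_diff)
  also have "\<dots> = (\<Sum>i<r. int (part lam i) - int (part mu i))"
  proof (rule sum.mono_neutral_left)
    show "\<forall>i\<in>{..<r} - {..<length lam}. int (part lam i) - int (part mu i) = 0"
    proof
      fix i assume "i \<in> {..<r} - {..<length lam}"
      then show "int (part lam i) - int (part mu i) = 0" using le[of i] by (simp add: Defs.part_def)
    qed
  qed (use assms in auto)
  also have "\<dots> = (\<Sum>i<r. int (bead_pos r lam i) - int (bead_pos r mu i))"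
    by (rule sum.cong) (simp_all add: bead_pos_def)
  finally show ?thesis .
qed

text \<open>Adjacent cells in different rows lie in one column, so a connected set that meets rows on both sides
of a horizontal line contains a vertical domino across it.\<close>

lemma path_crosses_rows:
  assumes "(adjacent_in D)\<^sup>*\<^sup>* a b" "fst a \<le> i" "i < fst b"
  shows "\<exists>j. (i, j) \<in> D \<and> (Suc i, j) \<in> D"
proof -
  have "fst b \<le> i \<or> (\<exists>j. (i, j) \<in> D \<and> (Suc i, j) \<in> D)"
    using assms(1)
  proof (induction rule: rtranclp_induct)
    case (step y z)
    obtain i' j' where y: "y = (i', j')" by force
    obtain i'' j'' where z: "z = (i'', j'')" by force
    show ?case
    proof (cases "i' \<le> i \<and> i < i''")
      case True
      then have "i' = i" "i'' = Suc i" "j' = j''" "y \<in> D" "z \<in> D"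
        using step.hyps(2) by (auto simp: adjacent_in_def y z)
      then show ?thesis using y z by blast
    qed (use step.IH in \<open>auto simp: y z\<close>)
  qed (use assms(2) in simp)
  then show ?thesis using assms(3) by auto
qed

text \<open>The bead positions \<open>b\<close> arise from \<open>a\<close> by deleting \<open>a s\<close>, shifting the indices between \<open>s\<close> and \<open>t\<close> and
inserting \<open>b t\<close>: as a set, one bead moves from \<open>a s\<close> to \<open>b t\<close>.\<close>

lemma sum_bead_shift:
  fixes a b :: "nat \<Rightarrow> nat"
  assumes "s \<le> t" "t < r" and "\<And>i. i < s \<Longrightarrow> b i = a i" "\<And>i. s \<le> i \<Longrightarrow> i < t \<Longrightarrow> b i = a (Suc i)"
    and "\<And>i. t < i \<Longrightarrow> i < r \<Longrightarrow> b i = a i"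
  shows "(\<Sum>i<r. int (a i) - int (b i)) = int (a s) - int (b t)"
    and "inj_on a {..<r} \<Longrightarrow> b ` {..<r} = insert (b t) (a ` {..<r} - {a s})"
proof -
  have "(\<Sum>i<r. int (a i) - int (b i)) = (\<Sum>i\<in>{s..t}. int (a i) - int (b i))"
    by (rule sum.mono_neutral_right) (use assms in auto)
  also have "{s..t} = insert t {s..<t}" using assms by auto
  also have "(\<Sum>i\<in>insert t {s..<t}. int (a i) - int (b i)) =
      (\<Sum>i\<in>{s..<t}. int (a i) - int (a (Suc i))) + (int (a t) - int (b t))"
    by (simp add: assms)
  also have "(\<Sum>i\<in>{s..<t}. int (a i) - int (a (Suc i))) = - (\<Sum>i\<in>{s..<t}. int (a (Suc i)) - int (a i))"
    by (simp add: sum_negf[symmetric])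
  also have "\<dots> = int (a s) - int (a t)"
    using sum_Suc_diff'[OF assms(1), of "\<lambda>i. int (a i)"] by simp
  finally show "(\<Sum>i<r. int (a i) - int (b i)) = int (a s) - int (b t)" by simp
  assume inj: "inj_on a {..<r}"
  have "{..<r} = insert t ({..<s} \<union> {s..<t} \<union> {t<..<r})" using assms by auto
  then have "b ` {..<r} = insert (b t) (b ` {..<s} \<union> b ` {s..<t} \<union> b ` {t<..<r})"
    by (simp add: image_Un)
  also have "b ` {..<s} = a ` {..<s}" using assms by (intro image_cong) auto
  also have "b ` {s..<t} = a ` Suc ` {s..<t}" unfolding image_image using assms by (intro image_cong) auto
  also have "b ` {t<..<r} = a ` {t<..<r}" using assms by (intro image_cong) auto
  also have "a ` {..<s} \<union> a ` Suc ` {s..<t} \<union> a ` {t<..<r} = a ` ({..<s} \<union> {Suc s..t} \<union> {t<..<r})"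
    by (simp add: image_Un atLeastLessThanSuc_atLeastAtMost)
  also have "{..<s} \<union> {Suc s..t} \<union> {t<..<r} = {..<r} - {s}" using assms by auto
  also have "a ` ({..<r} - {s}) = a ` {..<r} - {a s}"
    using inj assms by (subst inj_on_image_set_diff[OF inj]) auto
  finally show "b ` {..<r} = insert (b t) (a ` {..<r} - {a s})" .
qed

text \<open>Connectedness makes consecutive rows of a border strip overlap, and the absence of squares limits the
overlap to one column. Hence between the first row \<open>s\<close> and the last row \<open>t\<close> of the strip the beads of
\<open>\<kappa>\<close> are those of \<open>lam\<close> with the index shifted by one, and only one bead really moves. It moves by the
size of the strip.\<close>

lemma remove_strip_moves_bead:
  assumes strip: "remove_strip d lam \<kappa>" and r: "length lam \<le> r" and d: "d > 0"
  shows "\<exists>p\<in>beads r lam. d \<le> p \<and> p - d \<notin> beads r lam \<and>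
    beads r \<kappa> = insert (p - d) (beads r lam - {p})"
proof -
  define D where "D = skew_diagram lam \<kappa>"
  have bs: "border_strip lam \<kappa>" and size: "skew_size lam \<kappa> = d"
    using strip by (auto simp: remove_strip_def)
  have sp: "skew_partition lam \<kappa>" and ne: "D \<noteq> {}"
    and conn: "\<And>a b. a \<in> D \<Longrightarrow> b \<in> D \<Longrightarrow> (adjacent_in D)\<^sup>*\<^sup>* a b"
    and no_square: "\<And>i j. \<not> {(i, j), (i, Suc j), (Suc i, j), (Suc i, Suc j)} \<subseteq> D"
    using bs unfolding border_strip_def D_def by blast+
  have part: "is_partition lam" "is_partition \<kappa>" "\<And>i. part \<kappa> i \<le> part lam i"
    using sp by (auto simp: skew_partition_def)
  have mem: "(i, j) \<in> D \<longleftrightarrow> part \<kappa> i \<le> j \<and> j < part lam i" for i j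
    by (simp add: D_def skew_diagram_def)
  define R where "R = {i. part \<kappa> i < part lam i}"
  have Rr: "i < r" if "i \<in> R" for i using that r by (auto simp: R_def Defs.part_def split: if_splits)
  have finR: "finite R" by (rule finite_subset[of _ "{..<r}"]) (use Rr in auto)
  have neR: "R \<noteq> {}"
  proof -
    obtain i j where "(i, j) \<in> D" using ne by auto
    then have "i \<in> R" by (simp add: R_def mem)
    then show ?thesis by blast
  qed
  define s where "s = Min R"
  define t where "t = Max R"
  have st: "s \<in> R" "t \<in> R" "s \<le> t" "\<And>i. i \<in> R \<Longrightarrow> s \<le> i \<and> i \<le> t"
  proof -
    show "s \<in> R" "t \<in> R" using finR neR by (simp_all add: s_def t_def)
    then show "s \<le> t" using finR by (simp add: s_def)
    show "s \<le> i \<and> i \<le> t" if "i \<in> R" for i using finR that by (simp add: s_def t_def)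
  qed
  have shift: "part lam (Suc i) = Suc (part \<kappa> i)" if i: "s \<le> i" "i < t" for i
  proof -
    have "(s, part \<kappa> s) \<in> D" "(t, part \<kappa> t) \<in> D" using st by (auto simp: mem R_def)
    then have "(adjacent_in D)\<^sup>*\<^sup>* (s, part \<kappa> s) (t, part \<kappa> t)" by (rule conn)
    from path_crosses_rows[OF this, of i] obtain j where "(i, j) \<in> D" "(Suc i, j) \<in> D"
      using i by auto
    then have "part \<kappa> i < part lam (Suc i)" by (auto simp: mem)
    moreover have "part \<kappa> (Suc i) \<le> part \<kappa> i" "part lam (Suc i) \<le> part lam i"
      using part by (auto intro: part_antimono)
    moreover have "\<not> Suc (part \<kappa> i) < part lam (Suc i)"
    proof
      assume "Suc (part \<kappa> i) < part lam (Suc i)"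
      then have "{(i, part \<kappa> i), (i, Suc (part \<kappa> i)), (Suc i, part \<kappa> i), (Suc i, Suc (part \<kappa> i))} \<subseteq> D"
        using calculation by (auto simp: mem)
      then show False using no_square by blast
    qed
    ultimately show ?thesis by simp
  qed
  define a where "a = bead_pos r lam"
  define b where "b = bead_pos r \<kappa>"
  have outside: "b i = a i" if "i \<notin> R" for i
    using that part(3)[of i] by (simp add: a_def b_def bead_pos_def R_def)
  have before: "b i = a i" if "i < s" for i using outside[of i] st(4)[of i] that by force
  have after: "b i = a i" if "t < i" "i < r" for i using outside[of i] st(4)[of i] that by force
  have inside: "b i = a (Suc i)" if "s \<le> i" "i < t" for i
    using shift[OF that] Rr[OF st(2)] that by (simp add: a_def b_def bead_pos_def)
  have inj: "inj_on a {..<r}" "inj_on b {..<r}"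
    using bead_pos_eq_iff[OF part(1), of _ r] bead_pos_eq_iff[OF part(2), of _ r]
    by (auto simp: inj_on_def a_def b_def)
  have "int d = (\<Sum>i<r. int (a i) - int (b i))"
    using skew_size_eq_bead_sum[OF sp r] size by (simp add: a_def b_def)
  also have "\<dots> = int (a s) - int (b t)"
    by (rule sum_bead_shift(1)[where a = a and b = b, OF st(3) Rr[OF st(2)] before inside after])
  finally have bt: "a s = b t + d" by simp
  have img: "b ` {..<r} = insert (b t) (a ` {..<r} - {a s})"
    by (rule sum_bead_shift(2)[where a = a and b = b, OF st(3) Rr[OF st(2)] before inside after inj(1)])
  have "b t \<notin> a ` {..<r}"
  proof
    assume "b t \<in> a ` {..<r}"
    then have "b ` {..<r} = a ` {..<r} - {a s}" using img bt d by auto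
    moreover have "a s \<in> a ` {..<r}" using Rr[OF st(1)] by blast
    ultimately have "b ` {..<r} \<subset> a ` {..<r}" by blast
    then have "card (b ` {..<r}) < card (a ` {..<r})" by (intro psubset_card_mono) auto
    then show False using inj by (simp add: card_image)
  qed
  moreover have "a s \<in> a ` {..<r}" using Rr[OF st(1)] by blast
  moreover have "a s - d = b t" using bt by simp
  ultimately show ?thesis
    using img bt unfolding beads_eq_image a_def[symmetric] b_def[symmetric]
    by (intro bexI[of _ "a s"]) auto
qed

text \<open>The converse construction: let \<open>t\<close> be the last row whose bead lies beyond the target position \<open>e\<close>.
Shifting the beads between \<open>s\<close> and \<open>t\<close> by one index and placing the freed one at \<open>e\<close> gives row lengths
that decrease, and the removed cells form a border strip.\<close>

lemma movable_bead_gives_strip: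
  assumes lam: "is_partition lam" and r: "length lam \<le> r" and d: "d > 0"
    and p: "p \<in> beads r lam" "d \<le> p" "p - d \<notin> beads r lam"
  shows "\<exists>\<kappa>. remove_strip d lam \<kappa>"
proof -
  define a where "a = bead_pos r lam"
  define e where "e = p - d"
  have dec: "a j < a i" if "i < j" "j < r" for i j
    using bead_pos_strict_dec[OF lam that] by (simp add: a_def)
  obtain s where s: "s < r" "p = a s" using p(1) by (auto simp: beads_eq_image a_def)
  have e_ne: "a i \<noteq> e" if "i < r" for i using p(3) that unfolding beads_eq_image a_def e_def by (metis imageI lessThan_iff)
  define S where "S = {i. i < r \<and> e < a i}"
  have finS: "finite S" by (simp add: S_def)
  have sS: "s \<in> S" using s p d by (auto simp: S_def e_def)
  define t where "t = Max S"
  have tS: "t \<in> S" using finS sS by (auto simp: t_def intro: Max_in)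
  have t: "t < r" "e < a t" "s \<le> t" using tS finS sS by (auto simp: S_def t_def)
  have below: "a i < e" if "t < i" "i < r" for i
  proof -
    have "i \<notin> S" using that Max_ge[OF finS, of i] by (auto simp: t_def)
    then show ?thesis using e_ne[OF that(2)] that by (auto simp: S_def)
  qed
  have above: "e < a i" if "i \<le> t" for i
    using dec[of i t] t that by (cases "i = t") auto
  (* If e were smaller, the bead with index r - Suc e would be at position e or beyond, but it lies below e. *)
  have e_ge: "r - Suc t \<le> e"
  proof (rule ccontr)
    assume *: "\<not> ?thesis"
    then have "t < r - Suc e" "r - Suc e < r" by auto
    then have "a (r - Suc e) < e" by (rule below)
    then show False using * by (simp add: a_def bead_pos_def)
  qed
  define b where "b i = (if i < s \<or> t < i then a i else if i < t then a (Suc i) else e)" for i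
  define f where "f i = b i - (r - Suc i)" for i
  have b_le: "b i \<le> a i" if "i < r" for i
    using that dec[of i "Suc i"] above[of i] t by (auto simp: b_def)
  have part_pos: "1 \<le> part lam i" if "i \<le> t" for i
  proof -
    have "1 \<le> part lam t" using t e_ge by (auto simp: a_def bead_pos_def)
    then show ?thesis using part_antimono[OF lam that] by simp
  qed
  have b_ge: "r - Suc i \<le> b i" if "i < r" for i
    using that e_ge part_pos[of "Suc i"] by (auto simp: b_def a_def bead_pos_def)
  have bf: "b i = f i + (r - Suc i)" if "i < r" for i using b_ge[OF that] by (simp add: f_def)
  have b_dec: "b (Suc i) < b i" if "Suc i < r" for i
    using that dec[of i "Suc i"] dec[of "Suc i" "Suc (Suc i)"] dec[of i "Suc (Suc i)"]
      above[of i] above[of "Suc i"] below[of "Suc i"] t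
    by (auto simp: b_def)
  have f_dec: "f (Suc i) \<le> f i" if "Suc i < r" for i
    using b_dec[OF that] bf[of i] bf[of "Suc i"] that by simp
  obtain \<kappa> where \<kappa>: "is_partition \<kappa>" "length \<kappa> \<le> r" and part\<kappa>: "\<And>i. part \<kappa> i = (if i < r then f i else 0)"
    using partition_of_function[of r f] f_dec by blast
  have bpos: "bead_pos r \<kappa> i = b i" if "i < r" for i using that by (simp add: bead_pos_def part\<kappa> bf)
  have f_le: "f i \<le> part lam i" if "i < r" for i
    using b_le[OF that] bf[OF that] by (simp add: a_def bead_pos_def)
  have sp: "skew_partition lam \<kappa>"
    using lam \<kappa> f_le by (auto simp: skew_partition_def part\<kappa>)
  define D where "D = skew_diagram lam \<kappa>"
  have mem: "(i, j) \<in> D \<longleftrightarrow> s \<le> i \<and> i \<le> t \<and> f i \<le> j \<and> j < part lam i" for i j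
  proof (cases "i < r")
    case True
    have "f i = part lam i" if "i < s \<or> t < i"
      using that by (simp add: f_def b_def a_def bead_pos_def)
    then show ?thesis using True by (cases "i < s \<or> t < i") (auto simp: D_def skew_diagram_def part\<kappa>)
  next
    case False
    then show ?thesis using t r by (auto simp: D_def skew_diagram_def Defs.part_def)
  qed
  have f_lt: "f i < part lam i" if "s \<le> i" "i \<le> t" for i
  proof -
    have "b i < a i" using that dec[of i "Suc i"] above[of i] t by (auto simp: b_def)
    then show ?thesis using bf[of i] that t by (simp add: a_def bead_pos_def)
  qed
  have f_step: "Suc (f i) = part lam (Suc i)" if "s \<le> i" "i < t" for i
    using part_pos[of "Suc i"] that t by (simp add: f_def b_def a_def bead_pos_def)
  have row: "(adjacent_in D)\<^sup>*\<^sup>* (i, f i) (i, j)" if "(i, j) \<in> D" for i j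
  proof -
    have "f i \<le> j" "j < part lam i" "s \<le> i" "i \<le> t" using that by (auto simp: mem)
    then show ?thesis
    proof (induction j rule: dec_induct)
      case (step k)
      then have "adjacent_in D (i, k) (i, Suc k)" by (auto simp: adjacent_in_def mem)
      then show ?case using step by (auto intro: rtranclp.rtrancl_into_rtrancl)
    qed auto
  qed
  have start: "(adjacent_in D)\<^sup>*\<^sup>* (s, f s) (i, f i)" if "s \<le> i" "i \<le> t" for i
    using that
  proof (induction i rule: dec_induct)
    case (step i)
    have cell: "(Suc i, f i) \<in> D" "(i, f i) \<in> D"
      using step f_step[of i] f_dec[of i] f_lt[of i] t by (auto simp: mem)
    then have "adjacent_in D (i, f i) (Suc i, f i)" by (auto simp: adjacent_in_def)
    moreover have "symp (adjacent_in D)" by (auto simp: symp_def adjacent_in_def)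
    then have "(adjacent_in D)\<^sup>*\<^sup>* (Suc i, f i) (Suc i, f (Suc i))"
      using row[OF cell(1)] by (metis symp_rtranclp sympD)
    ultimately show ?case using step by (meson Suc_leD rtranclp.rtrancl_into_rtrancl rtranclp_trans)
  qed auto
  have from_start: "(adjacent_in D)\<^sup>*\<^sup>* (s, f s) c" if "c \<in> D" for c
  proof -
    obtain i j where c: "c = (i, j)" by force
    then have "s \<le> i" "i \<le> t" using that by (auto simp: mem)
    then show ?thesis using start[of i] row[of i j] that c by (metis rtranclp_trans)
  qed
  have conn: "(adjacent_in D)\<^sup>*\<^sup>* c c'" if "c \<in> D" "c' \<in> D" for c c'
  proof -
    have "symp (adjacent_in D)" by (auto simp: symp_def adjacent_in_def)
    then have "(adjacent_in D)\<^sup>*\<^sup>* c (s, f s)" using from_start[OF that(1)] by (metis symp_rtranclp sympD)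
    then show ?thesis using from_start[OF that(2)] by (rule rtranclp_trans)
  qed
  have "\<not> {(i, j), (i, Suc j), (Suc i, j), (Suc i, Suc j)} \<subseteq> D" for i j
    using f_step[of i] by (auto simp: mem)
  moreover have "D \<noteq> {}"
  proof -
    have "(s, f s) \<in> D" using f_lt[of s] t by (simp add: mem)
    then show ?thesis by blast
  qed
  ultimately have "border_strip lam \<kappa>"
    using sp conn unfolding border_strip_def D_def by blast
  moreover have "int (skew_size lam \<kappa>) = int d"
  proof -
    have "int (skew_size lam \<kappa>) = (\<Sum>i<r. int (a i) - int (b i))"
      unfolding skew_size_eq_bead_sum[OF sp r] by (rule sum.cong) (simp_all add: a_def bpos)
    also have "\<dots> = int (a s) - int (b t)"
      by (rule sum_bead_shift(1)) (use t in \<open>auto simp: b_def\<close>)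
    also have "\<dots> = int d" using s p t by (simp add: b_def e_def of_nat_diff)
    finally show ?thesis .
  qed
  ultimately show ?thesis unfolding remove_strip_def by auto
qed

lemma finite_runner_rows: "d > 0 \<Longrightarrow> finite (runner_rows d r \<kappa> i)"
proof -
  assume "d > 0"
  then have "inj_on (\<lambda>q. d * q + i) (runner_rows d r \<kappa> i)" by (auto simp: inj_on_def)
  moreover have "(\<lambda>q. d * q + i) ` runner_rows d r \<kappa> i \<subseteq> beads r \<kappa>" by (auto simp: runner_rows_def)
  ultimately show ?thesis using finite_beads finite_subset finite_imageD by metis
qed

text \<open>Moving a bead by \<open>d\<close> keeps it on its runner, one row higher up.\<close>

lemma remove_strip_runner_card:
  assumes "remove_strip d lam \<kappa>" "length lam \<le> r" "d > 0" "i < d"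
  shows "card (runner_rows d r \<kappa> i) = card (runner_rows d r lam i)"
proof -
  obtain p where p: "p \<in> beads r lam" "d \<le> p" "p - d \<notin> beads r lam"
    and \<kappa>: "beads r \<kappa> = insert (p - d) (beads r lam - {p})"
    using remove_strip_moves_bead[OF assms(1-3)] by blast
  define q where "q = p div d"
  have div_mod_eq: "x = y \<longleftrightarrow> x div d = y div d \<and> x mod d = y mod d" for x y
  proof
    assume "x div d = y div d \<and> x mod d = y mod d"
    then have "d * (x div d) + x mod d = d * (y div d) + y mod d" by simp
    then show "x = y" by (simp only: mult_div_mod_eq)
  qed simp
  have dm: "(d * k + i) div d = k" "(d * k + i) mod d = i" for k using assms(3,4) by auto
  have pos_p: "d * k + i = p \<longleftrightarrow> k = q \<and> i = p mod d" for k
    unfolding div_mod_eq[of _ p] dm q_def ..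
  have pos_pd: "d * k + i = p - d \<longleftrightarrow> k = q - 1 \<and> i = p mod d" for k
  proof -
    have "(p - d) div d = q - 1" "(p - d) mod d = p mod d"
      using le_div_geq[OF assms(3) p(2)] le_mod_geq[OF p(2)] by (simp_all only: q_def diff_Suc_1)
    then show ?thesis unfolding div_mod_eq[of _ "p - d"] dm by (simp only:)
  qed
  show ?thesis
  proof (cases "i = p mod d")
    case True
    have at: "d * k + i = p \<longleftrightarrow> k = q" "d * k + i = p - d \<longleftrightarrow> k = q - 1" for k
      using pos_p pos_pd True by blast+
    have "runner_rows d r \<kappa> i = insert (q - 1) (runner_rows d r lam i - {q})"
      unfolding runner_rows_def \<kappa> insert_iff Diff_iff singleton_iff at by blast
    moreover have "q \<in> runner_rows d r lam i"
      using p(1) at(1)[of q] unfolding runner_rows_def mem_Collect_eq by metis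
    moreover have "q - 1 \<notin> runner_rows d r lam i"
      using p(3) at(2)[of "q - 1"] unfolding runner_rows_def mem_Collect_eq by metis
    ultimately show ?thesis using finite_runner_rows[OF assms(3), of r lam i]
      by (simp only: card_insert_disjoint finite_Diff Diff_iff card_Suc_Diff1 simp_thms)
  next
    case False
    have "runner_rows d r \<kappa> i = runner_rows d r lam i"
      unfolding runner_rows_def \<kappa> insert_iff Diff_iff singleton_iff using pos_p pos_pd False by blast
    then show ?thesis by simp
  qed
qed

lemma remove_strip_reachable:
  assumes "(remove_strip d)\<^sup>*\<^sup>* lam \<kappa>" "is_partition lam" "length lam \<le> r" "d > 0"
  shows "is_partition \<kappa> \<and> length \<kappa> \<le> r \<and>
    (\<forall>i<d. card (runner_rows d r \<kappa> i) = card (runner_rows d r lam i))"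
  using assms(1)
proof (induction rule: rtranclp_induct)
  case (step \<kappa> \<kappa>')
  then have sp: "skew_partition \<kappa> \<kappa>'" by (simp add: remove_strip_def border_strip_def)
  then have "part \<kappa>' (length \<kappa>) \<le> part \<kappa> (length \<kappa>)" and \<kappa>': "is_partition \<kappa>'"
    by (auto simp: skew_partition_def)
  then have "part \<kappa>' (length \<kappa>) = 0" by (simp add: Defs.part_def)
  then have "length \<kappa>' \<le> length \<kappa>" using part_eq_0_iff[OF \<kappa>'] by blast
  then show ?case using step remove_strip_runner_card[of d \<kappa> \<kappa>' r] assms(4) \<kappa>' by auto
qed (use assms in auto)

text \<open>Each removal of a strip lowers the sum of the bead positions.\<close>

lemma core_exists:
  assumes "is_partition lam" "length lam \<le> r" "d > 0"
  shows "\<exists>\<kappa>. (remove_strip d)\<^sup>*\<^sup>* lam \<kappa> \<and> \<not> (\<exists>\<kappa>'. remove_strip d \<kappa> \<kappa>')"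
  using assms(1,2)
proof (induction "\<Sum>(beads r lam)" arbitrary: lam rule: less_induct)
  case less
  show ?case
  proof (cases "\<exists>\<kappa>. remove_strip d lam \<kappa>")
    case True
    then obtain \<kappa> where \<kappa>: "remove_strip d lam \<kappa>" by blast
    obtain p where p: "p \<in> beads r lam" "d \<le> p" "p - d \<notin> beads r lam"
      and b: "beads r \<kappa> = insert (p - d) (beads r lam - {p})"
      using remove_strip_moves_bead[OF \<kappa> less.prems(2) assms(3)] by blast
    have "\<Sum>(beads r \<kappa>) = (p - d) + \<Sum>(beads r lam - {p})"
      unfolding b using p by (subst sum.insert) (auto simp: finite_beads)
    also have "\<dots> < p + \<Sum>(beads r lam - {p})" using p assms(3) by simp
    also have "\<dots> = \<Sum>(beads r lam)" using p by (simp add: sum.remove[OF finite_beads])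
    finally obtain \<kappa>' where "(remove_strip d)\<^sup>*\<^sup>* \<kappa> \<kappa>'" "\<not> (\<exists>\<kappa>''. remove_strip d \<kappa>' \<kappa>'')"
      using less.hyps[of \<kappa>] remove_strip_reachable[of d lam \<kappa> r] \<kappa> less.prems assms(3) by blast
    then show ?thesis using \<kappa> by (meson converse_rtranclp_into_rtranclp)
  qed blast
qed

lemma downward_closed_nat_set:
  assumes "finite A" "\<And>q. Suc q \<in> A \<Longrightarrow> q \<in> A"
  shows "A = {..<card A}"
proof -
  have down: "q' \<in> A" if "q \<in> A" "q' \<le> q" for q q'
    using that(2,1) by (induction rule: inc_induct) (use assms(2) in auto)
  define m where "m = (LEAST q. q \<notin> A)"
  have "\<exists>q. q \<notin> A" using assms(1) ex_new_if_finite infinite_UNIV_nat by blast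
  then have "m \<notin> A" unfolding m_def by (rule LeastI_ex)
  moreover have "q \<in> A" if "q < m" for q using not_less_Least that unfolding m_def by blast
  ultimately have "A = {..<m}" using down by (auto simp: not_less[symmetric])
  then show ?thesis by simp
qed

text \<open>When no strip can be removed, no bead has a gap directly above it, so the beads of every runner fill
its topmost rows and are determined by their number.\<close>

lemma core_beads:
  assumes "is_partition \<kappa>" "length \<kappa> \<le> r" "d > 0" "\<not> (\<exists>\<kappa>'. remove_strip d \<kappa> \<kappa>')"
  shows "beads r \<kappa> = {p. p div d < card (runner_rows d r \<kappa> (p mod d))}"
proof -
  have "runner_rows d r \<kappa> i = {..<card (runner_rows d r \<kappa> i)}" for i
  proof (rule downward_closed_nat_set)
    fix q assume "Suc q \<in> runner_rows d r \<kappa> i"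
    then have "d * Suc q + i \<in> beads r \<kappa>" by (simp add: runner_rows_def)
    then have "d * Suc q + i - d \<in> beads r \<kappa>"
      using movable_bead_gives_strip[OF assms(1,2,3)] assms(4) by fastforce
    then show "q \<in> runner_rows d r \<kappa> i" by (simp add: runner_rows_def add.assoc)
  qed (rule finite_runner_rows[OF assms(3)])
  then have "p div d < card (runner_rows d r \<kappa> (p mod d)) \<longleftrightarrow> p div d \<in> runner_rows d r \<kappa> (p mod d)" for p
    by blast
  then show ?thesis by (auto simp: runner_rows_def)
qed

text \<open>The numbers of beads on the runners are invariant under the removal of strips and determine the
bead configuration of a partition without removable strips.\<close>

theorem d_core_eq_iff:
  assumes "is_partition lam" "is_partition mu" "length lam \<le> r" "length mu \<le> r" "d > 0"
  shows "d_core d lam = d_core d mu \<longleftrightarrow>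
    (\<forall>i<d. card (runner_rows d r lam i) = card (runner_rows d r mu i))"
proof -
  define core where "core lam \<kappa> \<longleftrightarrow> (remove_strip d)\<^sup>*\<^sup>* lam \<kappa> \<and> \<not> (\<exists>\<kappa>'. remove_strip d \<kappa> \<kappa>')" for lam \<kappa>
  have cards: "is_partition \<kappa> \<and> length \<kappa> \<le> r \<and>
      (\<forall>i<d. card (runner_rows d r \<kappa> i) = card (runner_rows d r lam i))"
    if "core lam \<kappa>" "is_partition lam" "length lam \<le> r" for lam \<kappa>
    using that remove_strip_reachable[of d lam \<kappa> r] assms(5) by (auto simp: core_def)
  have same: "\<kappa> = \<kappa>'" if "core lam \<kappa>" "core lam' \<kappa>'" "is_partition lam" "length lam \<le> r"
    "is_partition lam'" "length lam' \<le> r"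
    and eq: "\<forall>i<d. card (runner_rows d r lam i) = card (runner_rows d r lam' i)" for lam lam' \<kappa> \<kappa>'
  proof (rule beads_inject)
    have c: "card (runner_rows d r \<kappa> (p mod d)) = card (runner_rows d r \<kappa>' (p mod d))" for p
      using cards[of lam \<kappa>] cards[of lam' \<kappa>'] that assms(5) by simp
    show "beads r \<kappa> = beads r \<kappa>'"
      using core_beads[of \<kappa> r d] core_beads[of \<kappa>' r d] cards[of lam \<kappa>] cards[of lam' \<kappa>'] that assms(5)
      by (auto simp: core_def c)
  qed (use cards[of lam \<kappa>] cards[of lam' \<kappa>'] that in auto)
  have core: "core lam (d_core d lam)" if lam: "is_partition lam" "length lam \<le> r" for lam
  proof -
    obtain \<kappa> where \<kappa>: "core lam \<kappa>" using core_exists[OF lam assms(5)] by (auto simp: core_def)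
    then have "(THE \<kappa>. core lam \<kappa>) = \<kappa>" using same lam by (intro the_equality) auto
    moreover have "d_core d lam = (THE \<kappa>. core lam \<kappa>)" by (simp add: d_core_def core_def)
    ultimately show ?thesis using \<kappa> by simp
  qed
  show ?thesis
    using core[OF assms(1,3)] core[OF assms(2,4)] cards[of lam "d_core d lam"] cards[of mu "d_core d mu"]
      same[of lam "d_core d lam" mu "d_core d mu"] assms by metis
qed

section \<open>Quotients and the factorisation of the determinant\<close>

lemma ssyt_eq_tableaux: "ssyt lam mu N = tableaux (skew_diagram lam mu) N"
  by (simp add: ssyt_def tableaux_def)

lemma skew_schur_eq_tableau_sum: "skew_schur lam mu xs = tableau_sum (skew_diagram lam mu) xs"
  by (simp add: skew_schur_def tableau_sum_def ssyt_eq_tableaux)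

lemma skew_diagram_eq_shape:
  "length lam \<le> r \<Longrightarrow> skew_diagram lam mu = shape r (part lam) (part mu)"
  by (auto simp: skew_diagram_def Defs.part_def split: if_splits)

lemma card_skew_diagram: "card (skew_diagram lam mu) = skew_size lam mu"
  by (simp add: skew_diagram_eq_shape[OF order_refl] shape_def skew_size_def)

text \<open>Rows of length zero beyond the parts change neither the shape nor the determinant, so the number \<open>k\<close> of
rows is free. This is needed for quotients, where \<open>k\<close> is the number of beads on a runner.\<close>

lemma skew_schur_jacobi_trudi:
  fixes xs :: "'a::comm_ring_1 list"
  assumes "is_partition \<alpha>" "is_partition \<beta>" "length \<alpha> \<le> k" "length \<beta> \<le> k"
  shows "jacobi_trudi k (part \<alpha>) (part \<beta>) xs = (if skew_partition \<alpha> \<beta> then skew_schur \<alpha> \<beta> xs else 0)"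
proof -
  have "(\<forall>i<k. part \<beta> i \<le> part \<alpha> i) \<longleftrightarrow> skew_partition \<alpha> \<beta>"
  proof -
    have "part \<beta> i = 0" if "\<not> i < k" for i using that assms by (simp add: Defs.part_def)
    then show ?thesis using assms unfolding skew_partition_def by (metis le0)
  qed
  moreover have "antimono_on {..<k} (part \<alpha>)" "antimono_on {..<k} (part \<beta>)"
    using part_antimono assms(1,2) by (auto intro!: monotone_onI)
  ultimately show ?thesis
    using jacobi_trudi[of k "part \<alpha>" "part \<beta>" xs]
    by (simp add: skew_schur_eq_tableau_sum skew_diagram_eq_shape[OF assms(3)])
qed

text \<open>Bead positions differ from \<open>part lam i - i\<close> by the constant \<open>r - 1\<close>, which cancels in differences.\<close>

lemma jacobi_trudi_eq_pair_det:
  "jacobi_trudi r (part lam) (part mu) xs =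
    pair_det (\<lambda>a b. hsym xs (int a - int b)) (map (bead_pos r lam) [0..<r]) (map (bead_pos r mu) [0..<r])"
proof -
  have "int (part lam i) - int i - (int (part mu j) - int j) = int (bead_pos r lam i) - int (bead_pos r mu j)"
    if "i < r" "j < r" for i j
    using that by (simp add: bead_pos_def of_nat_diff)
  then show ?thesis unfolding jacobi_trudi_def pair_det_def
    by (intro arg_cong[where f = det] eq_matI) auto
qed

lemma nth_sorted_list_of_set_card_less:
  fixes A :: "nat set"
  assumes "finite A" "m < card A"
  shows "card {x. x < sorted_list_of_set A ! m \<and> x \<in> A} = m"
proof -
  define S where "S = sorted_list_of_set A"
  have S: "set S = A" "length S = card A" "sorted_wrt (<) S"
    using assms(1) by (auto simp: S_def)
  have lt: "S ! i < S ! j \<longleftrightarrow> i < j" if "i < length S" "j < length S" for i j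
    using S(3) that by (metis sorted_wrt_nth_less linorder_neqE_nat less_asym less_irrefl)
  have "{x. x < S ! m \<and> x \<in> A} = (\<lambda>i. S ! i) ` {..<m}"
  proof (intro equalityI subsetI)
    fix x assume x: "x \<in> {x. x < S ! m \<and> x \<in> A}"
    then obtain i where i: "i < length S" "x = S ! i" using S(1) by (auto simp: in_set_conv_nth)
    then show "x \<in> (\<lambda>i. S ! i) ` {..<m}" using x lt[of i m] assms(2) S(2) by auto
  next
    fix x assume "x \<in> (\<lambda>i. S ! i) ` {..<m}"
    then obtain i where "i < m" "x = S ! i" by auto
    then show "x \<in> {x. x < S ! m \<and> x \<in> A}"
      using lt[of i m] assms(2) S nth_mem[of i S] by auto
  qed
  moreover have "inj_on (\<lambda>i. S ! i) {..<m}"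
    using assms(2) S(2) lt by (intro linorder_inj_onI) (auto simp: less_imp_neq)
  ultimately show ?thesis by (simp add: card_image S_def)
qed

definition runner_list :: "nat \<Rightarrow> nat \<Rightarrow> nat list \<Rightarrow> nat \<Rightarrow> nat list" where
  "runner_list d r \<kappa> i = rev (sorted_list_of_set (runner_rows d r \<kappa> i))"

lemma runner_list_props:
  assumes "d > 0"
  shows "set (runner_list d r \<kappa> i) = runner_rows d r \<kappa> i"
    "distinct (runner_list d r \<kappa> i)"
    "length (runner_list d r \<kappa> i) = card (runner_rows d r \<kappa> i)"
  using finite_runner_rows[OF assms] by (auto simp: runner_list_def)

text \<open>The partition read off from a runner has the rows of the runner as its own beads: below the \<open>j\<close>th bead
from the bottom there are \<open>j\<close> beads, hence \<open>k - Suc j\<close> above it, and the remaining rows above it are gaps.\<close>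

lemma runner_partition_props:
  assumes d: "d > 0" and k: "k = card (runner_rows d r \<kappa> i)"
  shows "is_partition (runner_partition d r \<kappa> i)" (is ?p)
    and "length (runner_partition d r \<kappa> i) \<le> k" (is ?l)
    and "j < k \<Longrightarrow> bead_pos k (runner_partition d r \<kappa> i) j = runner_list d r \<kappa> i ! j"
proof -
  define A where "A = runner_rows d r \<kappa> i"
  define L where "L = runner_list d r \<kappa> i"
  define gaps where "gaps q = card {q'. q' < q \<and> q' \<notin> A}" for q
  have finA: "finite A" using finite_runner_rows[OF d] by (simp add: A_def)
  have len: "length L = k" using runner_list_props[OF d] by (simp add: L_def k)
  have \<alpha>: "runner_partition d r \<kappa> i = filter (\<lambda>k. k \<noteq> 0) (map gaps L)"
    by (simp add: runner_partition_def gaps_def[abs_def] A_def L_def runner_list_def)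
  have gaps: "gaps (L ! j) + (k - Suc j) = L ! j" if j: "j < k" for j
  proof -
    define q where "q = L ! j"
    have "q = sorted_list_of_set A ! (k - Suc j)"
      using j len by (simp add: q_def L_def runner_list_def rev_nth A_def)
    then have "card {q'. q' < q \<and> q' \<in> A} = k - Suc j"
      using nth_sorted_list_of_set_card_less[OF finA, of "k - Suc j"] j by (simp add: k A_def)
    moreover have "gaps q + card {q'. q' < q \<and> q' \<in> A} = card ({q'. q' < q \<and> q' \<notin> A} \<union> {q'. q' < q \<and> q' \<in> A})"
      unfolding gaps_def by (rule card_Un_disjoint[symmetric]) auto
    moreover have "{q'. q' < q \<and> q' \<notin> A} \<union> {q'. q' < q \<and> q' \<in> A} = {..<q}" by auto
    ultimately show ?thesis by (simp add: q_def)
  qed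
  have "sorted_wrt (\<ge>) L" by (simp add: L_def runner_list_def sorted_wrt_rev)
  (* A higher bead has at most as many gaps above it. *)
  then have "sorted_wrt (\<lambda>a b. gaps b \<le> gaps a) L"
    by (rule sorted_wrt_mono_rel[rotated]) (auto simp: gaps_def intro!: card_mono)
  then have sorted: "sorted_wrt (\<ge>) (map gaps L)" by (simp add: sorted_wrt_map)
  show ?p unfolding \<alpha> by (rule is_partition_filter_nonzero[OF sorted])
  show ?l unfolding \<alpha> using length_filter_le[of _ "map gaps L"] len by (metis length_map)
  show "bead_pos k (runner_partition d r \<kappa> i) j = runner_list d r \<kappa> i ! j" if "j < k"
  proof -
    have "part (runner_partition d r \<kappa> i) j = gaps (L ! j)"
      unfolding \<alpha> part_filter_nonzero[OF sorted] using that len by simp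
    then show ?thesis using gaps[OF that] by (simp only: bead_pos_def L_def)
  qed
qed

lemma runner_list_eq_map_bead_pos:
  assumes "d > 0" "k = card (runner_rows d r \<kappa> i)"
  shows "runner_list d r \<kappa> i = map (bead_pos k (runner_partition d r \<kappa> i)) [0..<k]"
  using runner_partition_props(3)[OF assms] runner_list_props(3)[OF assms(1), of r \<kappa> i] assms(2)
  by (intro nth_equalityI) auto

lemma distinct_concat_map:
  assumes "distinct I" "\<And>i. i \<in> set I \<Longrightarrow> distinct (A i)"
    "\<And>i j. i \<in> set I \<Longrightarrow> j \<in> set I \<Longrightarrow> i \<noteq> j \<Longrightarrow> set (A i) \<inter> set (A j) = {}"
  shows "distinct (concat (map A I))"
  using assms
proof (induction I)
  case (Cons i I)
  have "distinct (concat (map A I))" using Cons.prems by (intro Cons.IH) auto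
  moreover have "set (A i) \<inter> set (A j) = {}" if "j \<in> set I" for j
    using that Cons.prems(1) by (intro Cons.prems(3)) auto
  ultimately show ?case using Cons.prems(2) by auto
qed simp

lemma mset_beads_by_runner:
  assumes "is_partition \<kappa>" "d > 0"
  shows "mset (map (bead_pos r \<kappa>) [0..<r]) =
    mset (concat (map (\<lambda>i. map (\<lambda>q. d * q + i) (runner_list d r \<kappa> i)) [0..<d]))"
proof (rule set_eq_iff_mset_eq_distinct[THEN iffD1])
  show "distinct (map (bead_pos r \<kappa>) [0..<r])"
    using bead_pos_eq_iff[OF assms(1)] by (auto simp: distinct_map inj_on_def)
  have rem: "(d * q + i) mod d = i" if "i < d" for q i using that by simp
  show "distinct (concat (map (\<lambda>i. map (\<lambda>q. d * q + i) (runner_list d r \<kappa> i)) [0..<d]))"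
  proof (rule distinct_concat_map)
    fix i j assume "i \<in> set [0..<d]" "j \<in> set [0..<d]" "i \<noteq> j"
    then show "set (map (\<lambda>q. d * q + i) (runner_list d r \<kappa> i)) \<inter>
        set (map (\<lambda>q. d * q + j) (runner_list d r \<kappa> j)) = {}"
      using rem by (auto, metis)
  qed (use assms(2) in \<open>auto simp: distinct_map inj_on_def runner_list_props\<close>)
  have "p \<in> beads r \<kappa> \<longleftrightarrow> (\<exists>i<d. \<exists>q\<in>runner_rows d r \<kappa> i. p = d * q + i)" for p
  proof
    assume "p \<in> beads r \<kappa>"
    then have "p mod d < d" "p div d \<in> runner_rows d r \<kappa> (p mod d)" "p = d * (p div d) + p mod d"
      using assms(2) by (auto simp: runner_rows_def)
    then show "\<exists>i<d. \<exists>q\<in>runner_rows d r \<kappa> i. p = d * q + i" by blast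
  qed (auto simp: runner_rows_def)
  moreover have "set (concat (map (\<lambda>i. map (\<lambda>q. d * q + i) (runner_list d r \<kappa> i)) [0..<d])) =
      {p. \<exists>i<d. \<exists>q\<in>runner_rows d r \<kappa> i. p = d * q + i}"
    by (auto simp: runner_list_props[OF assms(2)])
  moreover have "set (map (bead_pos r \<kappa>) [0..<r]) = beads r \<kappa>"
    by (simp add: beads_eq_image atLeast0LessThan)
  ultimately show "set (map (bead_pos r \<kappa>) [0..<r]) =
      set (concat (map (\<lambda>i. map (\<lambda>q. d * q + i) (runner_list d r \<kappa> i)) [0..<d]))"
    by blast
qed

lemma length_filter_beads_runner:
  assumes "is_partition \<kappa>" "i < d"
  shows "length (filter (\<lambda>p. p mod d = i) (map (bead_pos r \<kappa>) [0..<r])) = card (runner_rows d r \<kappa> i)"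
proof -
  have "distinct (map (bead_pos r \<kappa>) [0..<r])"
    using bead_pos_eq_iff[OF assms(1)] by (auto simp: distinct_map inj_on_def)
  then have "length (filter (\<lambda>p. p mod d = i) (map (bead_pos r \<kappa>) [0..<r])) =
      card ({p. p mod d = i} \<inter> beads r \<kappa>)"
    by (subst distinct_length_filter) (auto simp: beads_eq_image atLeast0LessThan)
  also have "{p. p mod d = i} \<inter> beads r \<kappa> = (\<lambda>q. d * q + i) ` runner_rows d r \<kappa> i"
  proof (intro equalityI subsetI)
    fix p assume "p \<in> {p. p mod d = i} \<inter> beads r \<kappa>"
    then have "p = d * (p div d) + i" "p \<in> beads r \<kappa>" by auto
    then show "p \<in> (\<lambda>q. d * q + i) ` runner_rows d r \<kappa> i" by (auto simp: runner_rows_def)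
  qed (use assms(2) in \<open>auto simp: runner_rows_def\<close>)
  also have "card \<dots> = card (runner_rows d r \<kappa> i)"
    using assms(2) by (intro card_image) (auto simp: inj_on_def)
  finally show ?thesis .
qed

lemma hsym_roots_of_unity_int:
  assumes "primitive_root_of_unity d \<omega>" "d > 0"
  shows "hsym (map (\<lambda>k. \<omega> ^ k) [0..<d * M]) (int d * k) = hsym (replicate M 1) k" (is ?dvd)
    and "\<not> int d dvd k \<Longrightarrow> hsym (map (\<lambda>k. \<omega> ^ k) [0..<d * M]) k = 0"
proof -
  show ?dvd
  proof (cases "k < 0")
    case True
    then have "int d * k < 0" using assms(2) by (simp add: mult_pos_neg)
    then show ?thesis using True by (simp only: hsym_neg)
  next
    case False
    then have k: "k = int (nat k)" by simp
    have "int d * k = int (d * nat k)" using False by simp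
    then have "hsym (map (\<lambda>k. \<omega> ^ k) [0..<d * M]) (int d * k) = hsym (replicate M 1) (int (d * nat k div d))"
      using hsym_roots_of_unity[OF assms, of M "d * nat k"] by (simp only: dvd_triv_left if_True)
    also have "d * nat k div d = nat k" using assms(2) by simp
    finally show ?thesis using k by (simp only:)
  qed
  show "hsym (map (\<lambda>k. \<omega> ^ k) [0..<d * M]) k = 0" if "\<not> int d dvd k"
  proof (cases "k < 0")
    case False
    then have k: "k = int (nat k)" by simp
    then have "\<not> d dvd nat k" using that by (metis of_nat_dvd_iff)
    then show ?thesis using hsym_roots_of_unity[OF assms, of M "nat k"] k by (simp only: if_False)
  qed simp
qed

lemma pair_det_map:
  assumes "length as = length bs"
  shows "pair_det g (map f as) (map h bs) = pair_det (\<lambda>a b. g (f a) (h b)) as bs"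
  unfolding pair_det_def using assms by (intro arg_cong[where f = det] eq_matI) auto

lemma skew_partition_parts:
  assumes "skew_partition lam mu"
  shows "is_partition lam" "is_partition mu" "length mu \<le> length lam"
proof -
  show p: "is_partition lam" "is_partition mu" using assms by (auto simp: skew_partition_def)
  have "part mu (length lam) \<le> part lam (length lam)" using assms by (auto simp: skew_partition_def)
  then show "length mu \<le> length lam" using part_eq_0_iff[OF p(2), of "length lam"] by (simp add: Defs.part_def)
qed

lemma skew_schur_eq_pair_det:
  fixes xs :: "'a::comm_ring_1 list"
  assumes skew: "skew_partition lam mu" and r: "length lam \<le> r"
  shows "skew_schur lam mu xs = pair_det (\<lambda>a b. hsym xs (int a - int b))
    (map (bead_pos r lam) [0..<r]) (map (bead_pos r mu) [0..<r])"
  using skew_schur_jacobi_trudi[of lam mu r xs] skew_partition_parts[OF skew] skew r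
  by (simp add: jacobi_trudi_eq_pair_det)

lemma different_runner:
  fixes a b d :: nat
  shows "a mod d \<noteq> b mod d \<Longrightarrow> \<not> int d dvd int a - int b"
  by (simp add: mod_eq_dvd_iff[symmetric] zmod_int[symmetric])

text \<open>The entry of the determinant for beads on different runners is zero, and one runner carries different
numbers of row and column labels.\<close>

lemma skew_schur_roots_unbalanced:
  assumes skew: "skew_partition lam mu" and r: "length lam \<le> r"
    and d: "d > 0" and \<omega>: "primitive_root_of_unity d \<omega>"
    and i: "i < d" "card (runner_rows d r lam i) \<noteq> card (runner_rows d r mu i)"
  shows "skew_schur lam mu (map (\<lambda>k. \<omega> ^ k) [0..<d * M]) = 0"
  unfolding skew_schur_eq_pair_det[OF skew r]
proof (rule pair_det_eq_0_if_unbalanced[where P = "\<lambda>p. p mod d = i" and Q = "\<lambda>p. p mod d = i"])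
  show "hsym (map (\<lambda>k. \<omega> ^ k) [0..<d * M]) (int a - int b) = 0" if "(a mod d = i) \<noteq> (b mod d = i)" for a b
    by (rule hsym_roots_of_unity_int(2)[OF \<omega> d different_runner]) (use that in auto)
  show "length (filter (\<lambda>p. p mod d = i) (map (bead_pos r lam) [0..<r])) \<noteq>
      length (filter (\<lambda>p. p mod d = i) (map (bead_pos r mu) [0..<r]))"
    using skew_partition_parts[OF skew] i by (simp only: length_filter_beads_runner not_False_eq_True)
qed simp

text \<open>After sorting the beads by runners the matrix is block diagonal. Within the block of runner \<open>i\<close> the beads
are \<open>d q + i\<close> with \<open>q\<close> a row, and the entry depends on the difference of the rows as for the quotient
partitions at \<open>M\<close> ones.\<close>

lemma skew_schur_roots_balanced:
  assumes skew: "skew_partition lam mu" and r: "length lam \<le> r"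
    and d: "d > 0" and \<omega>: "primitive_root_of_unity d \<omega>"
    and bal: "\<And>i. i < d \<Longrightarrow> card (runner_rows d r lam i) = card (runner_rows d r mu i)"
  obtains \<epsilon> :: int where "\<epsilon> = 1 \<or> \<epsilon> = -1"
    "\<And>M. skew_schur lam mu (map (\<lambda>k. \<omega> ^ k) [0..<d * M]) = of_int \<epsilon> *
      (\<Prod>i\<leftarrow>[0..<d].
         if skew_partition (runner_partition d r lam i) (runner_partition d r mu i)
         then skew_schur (runner_partition d r lam i) (runner_partition d r mu i) (replicate M 1) else 0)"
proof -
  note parts = skew_partition_parts[OF skew]
  define A where "A \<kappa> i = map (\<lambda>q. d * q + i) (runner_list d r \<kappa> i)" for \<kappa> i
  have m: "mset (map (bead_pos r lam) [0..<r]) = mset (concat (map (A lam) [0..<d]))"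
    "mset (map (bead_pos r mu) [0..<r]) = mset (concat (map (A mu) [0..<d]))"
    unfolding A_def using mset_beads_by_runner parts d by blast+
  have len: "length (concat (map (A lam) [0..<d])) = length (concat (map (A mu) [0..<d]))"
    using m[THEN arg_cong[where f = size]] unfolding size_mset length_map by (simp only:)
  obtain \<epsilon> :: int where \<epsilon>: "\<epsilon> = 1 \<or> \<epsilon> = -1" and perm:
    "\<And>g :: nat \<Rightarrow> nat \<Rightarrow> complex. pair_det g (map (bead_pos r lam) [0..<r]) (map (bead_pos r mu) [0..<r]) =
      of_int \<epsilon> * pair_det g (concat (map (A lam) [0..<d])) (concat (map (A mu) [0..<d]))"
    by (rule pair_det_permute[OF m len, where ?'a = complex]) (rule that)
  have "skew_schur lam mu (map (\<lambda>k. \<omega> ^ k) [0..<d * M]) = of_int \<epsilon> *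
      (\<Prod>i\<leftarrow>[0..<d].
         if skew_partition (runner_partition d r lam i) (runner_partition d r mu i)
         then skew_schur (runner_partition d r lam i) (runner_partition d r mu i) (replicate M 1) else 0)" for M
  proof -
    define xs where "xs = map (\<lambda>k. \<omega> ^ k) [0..<d * M]"
    define g where "g a b = hsym xs (int a - int b)" for a b
    have "skew_schur lam mu xs = of_int \<epsilon> * pair_det g (concat (map (A lam) [0..<d])) (concat (map (A mu) [0..<d]))"
      unfolding skew_schur_eq_pair_det[OF skew r] g_def[symmetric] by (rule perm)
    also have "pair_det g (concat (map (A lam) [0..<d])) (concat (map (A mu) [0..<d])) =
        (\<Prod>i\<leftarrow>[0..<d]. pair_det g (A lam i) (A mu i))"
    proof (rule pair_det_concat)
      show "length (A lam i) = length (A mu i)" if "i \<in> set [0..<d]" for i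
        using that by (simp add: A_def runner_list_props[OF d] bal)
      show "g a b = 0" if "i \<in> set [0..<d]" "j \<in> set [0..<d]" "i \<noteq> j" "a \<in> set (A lam i)" "b \<in> set (A mu j)" for i j a b
      proof -
        have "a mod d = i" "b mod d = j" using that by (auto simp: A_def)
        then show ?thesis unfolding g_def xs_def
          using that by (intro hsym_roots_of_unity_int(2)[OF \<omega> d different_runner]) simp
      qed
    qed simp
    also have "\<dots> = (\<Prod>i\<leftarrow>[0..<d]. if skew_partition (runner_partition d r lam i) (runner_partition d r mu i)
        then skew_schur (runner_partition d r lam i) (runner_partition d r mu i) (replicate M 1) else 0)"
    proof (intro arg_cong[where f = prod_list] map_cong refl)
      fix i assume "i \<in> set [0..<d]"
      then have i: "i < d" by simp
      define k where "k = card (runner_rows d r lam i)"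
      have k': "k = card (runner_rows d r mu i)" using bal[OF i] by (simp add: k_def)
      define \<alpha> where "\<alpha> = runner_partition d r lam i"
      define \<beta> where "\<beta> = runner_partition d r mu i"
      have "pair_det g (A lam i) (A mu i) =
          pair_det (\<lambda>a b. g (d * a + i) (d * b + i)) (runner_list d r lam i) (runner_list d r mu i)"
        unfolding A_def by (rule pair_det_map) (simp add: runner_list_props[OF d] bal[OF i])
      also have "(\<lambda>a b. g (d * a + i) (d * b + i)) = (\<lambda>a b. hsym (replicate M 1) (int a - int b))"
      proof (intro ext)
        fix a b
        have "int (d * a + i) - int (d * b + i) = int d * (int a - int b)" by (simp add: right_diff_distrib)
        then show "g (d * a + i) (d * b + i) = hsym (replicate M 1) (int a - int b)"
          unfolding g_def xs_def by (simp only: hsym_roots_of_unity_int(1)[OF \<omega> d])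
      qed
      also have "pair_det \<dots> (runner_list d r lam i) (runner_list d r mu i) =
          jacobi_trudi k (part \<alpha>) (part \<beta>) (replicate M 1)"
        unfolding jacobi_trudi_eq_pair_det runner_list_eq_map_bead_pos[OF d k_def]
          runner_list_eq_map_bead_pos[OF d k'] \<alpha>_def \<beta>_def ..
      also have "\<dots> = (if skew_partition \<alpha> \<beta> then skew_schur \<alpha> \<beta> (replicate M 1) else 0)"
        using runner_partition_props(1,2)[OF d k_def] runner_partition_props(1,2)[OF d k']
        by (intro skew_schur_jacobi_trudi) (auto simp: \<alpha>_def \<beta>_def)
      finally show "pair_det g (A lam i) (A mu i) = (if skew_partition (runner_partition d r lam i) (runner_partition d r mu i)
        then skew_schur (runner_partition d r lam i) (runner_partition d r mu i) (replicate M 1) else 0)"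
        by (simp only: \<alpha>_def \<beta>_def)
    qed
    finally show ?thesis by (simp only: xs_def)
  qed
  then show ?thesis using that \<epsilon> by blast
qed

text \<open>The size is the difference of the sums of bead positions. On runner \<open>i\<close> the position \<open>d q + i\<close>
contributes \<open>d q\<close>, the offsets \<open>i\<close> cancel because the bead counts agree, and the rows \<open>q\<close> are the beads
of the quotient partitions.\<close>

lemma skew_size_eq_quotient_sizes:
  assumes skew: "skew_partition lam mu" and r: "length lam \<le> r" and d: "d > 0"
    and bal: "\<And>i. i < d \<Longrightarrow> card (runner_rows d r lam i) = card (runner_rows d r mu i)"
    and quot: "\<And>i. i < d \<Longrightarrow> skew_partition (runner_partition d r lam i) (runner_partition d r mu i)"
  shows "skew_size lam mu = d * (\<Sum>i<d. skew_size (runner_partition d r lam i) (runner_partition d r mu i))"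
proof -
  note parts = skew_partition_parts[OF skew]
  have bead_sum: "(\<Sum>i<r. int (bead_pos r \<kappa> i)) =
      (\<Sum>i<d. int d * (\<Sum>q\<leftarrow>runner_list d r \<kappa> i. int q) + int i * int (card (runner_rows d r \<kappa> i)))"
    if "is_partition \<kappa>" for \<kappa>
  proof -
    have "(\<Sum>i<r. int (bead_pos r \<kappa> i)) = (\<Sum>p\<in>#mset (map (bead_pos r \<kappa>) [0..<r]). int p)"
      by (simp add: sum_unfold_sum_mset atLeast0LessThan[symmetric] image_mset.compositionality o_def flip: mset_upt)
    also have "\<dots> = (\<Sum>p\<leftarrow>concat (map (\<lambda>i. map (\<lambda>q. d * q + i) (runner_list d r \<kappa> i)) [0..<d]). int p)"
      unfolding mset_beads_by_runner[OF that d] by (simp only: mset_map[symmetric] sum_mset_sum_list)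
    also have "\<dots> = (\<Sum>i\<leftarrow>[0..<d]. \<Sum>p\<leftarrow>map (\<lambda>q. d * q + i) (runner_list d r \<kappa> i). int p)"
    proof -
      have "sum_list (concat L) = sum_list (map sum_list L)" for L :: "int list list"
        by (induction L) simp_all
      then show ?thesis unfolding map_concat map_map by (simp add: o_def)
    qed
    also have "\<dots> = (\<Sum>i\<leftarrow>[0..<d]. int d * (\<Sum>q\<leftarrow>runner_list d r \<kappa> i. int q) + int i * int (card (runner_rows d r \<kappa> i)))"
    proof (intro arg_cong[where f = sum_list] map_cong refl)
      fix i
      have "(\<Sum>p\<leftarrow>map (\<lambda>q. d * q + i) L. int p) = int d * (\<Sum>q\<leftarrow>L. int q) + int i * int (length L)" for L
        by (induction L) (simp_all add: algebra_simps)
      then show "(\<Sum>p\<leftarrow>map (\<lambda>q. d * q + i) (runner_list d r \<kappa> i). int p) =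
          int d * (\<Sum>q\<leftarrow>runner_list d r \<kappa> i. int q) + int i * int (card (runner_rows d r \<kappa> i))"
        unfolding runner_list_props(3)[OF d, symmetric] .
    qed
    finally show ?thesis by (simp add: sum_list_sum_nth atLeast0LessThan)
  qed
  have runner_sum: "(\<Sum>q\<leftarrow>runner_list d r lam i. int q) - (\<Sum>q\<leftarrow>runner_list d r mu i. int q) =
      int (skew_size (runner_partition d r lam i) (runner_partition d r mu i))" if i: "i < d" for i
  proof -
    define k where "k = card (runner_rows d r lam i)"
    have k': "k = card (runner_rows d r mu i)" using bal[OF i] by (simp add: k_def)
    show ?thesis
      unfolding skew_size_eq_bead_sum[OF quot[OF i] runner_partition_props(2)[OF d k_def]]
        runner_list_eq_map_bead_pos[OF d k_def] runner_list_eq_map_bead_pos[OF d k']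
      by (simp add: sum_list_sum_nth atLeast0LessThan sum_subtractf)
  qed
  have "int (skew_size lam mu) = (\<Sum>i<r. int (bead_pos r lam i)) - (\<Sum>i<r. int (bead_pos r mu i))"
    by (simp add: skew_size_eq_bead_sum[OF skew r] sum_subtractf)
  also have "\<dots> = (\<Sum>i<d. int d * int (skew_size (runner_partition d r lam i) (runner_partition d r mu i)))"
    unfolding bead_sum[OF parts(1)] bead_sum[OF parts(2)] sum_subtractf[symmetric]
    by (rule sum.cong) (simp_all add: bal runner_sum[symmetric] right_diff_distrib)
  also have "\<dots> = int (d * (\<Sum>i<d. skew_size (runner_partition d r lam i) (runner_partition d r mu i)))"
    by (simp add: sum_distrib_left)
  finally show ?thesis by (simp only: of_nat_eq_iff)
qed

section \<open>The sign of the character value\<close>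

text \<open>Cut the \<open>K t\<close> possible entries into \<open>K\<close> consecutive blocks of length \<open>t\<close>. A filling that chooses the
entry of the cell \<open>(i, j)\<close> arbitrarily in block \<open>i + j\<close> increases strictly along rows and columns.\<close>

lemma card_tableaux_lower_bound:
  assumes "finite D" "\<And>i j. (i, j) \<in> D \<Longrightarrow> i + j < K"
  shows "t ^ card D \<le> card (tableaux D (K * t))"
proof -
  define G where "G = D \<rightarrow>\<^sub>E {..<t}"
  define F where "F g = (\<lambda>(i, j)\<in>D. (i + j) * t + g (i, j))" for g :: "nat \<times> nat \<Rightarrow> nat"
  have less: "F g (i, j) < F g (i', j')" if g: "g \<in> G" and "(i, j) \<in> D" "(i', j') \<in> D" "i + j < i' + j'" for g i j i' j'
  proof -
    have "g (i, j) < t" using g that(2) by (auto simp: G_def PiE_def Pi_def)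
    then have "F g (i, j) < Suc (i + j) * t" using that by (simp add: F_def)
    also have "\<dots> \<le> (i' + j') * t" using that(4) by (intro mult_le_mono1) simp
    also have "\<dots> \<le> F g (i', j')" using that by (simp add: F_def)
    finally show ?thesis .
  qed
  have "F g c < K * t" if g: "g \<in> G" and c: "c \<in> D" for g c
  proof -
    obtain i j where ij: "c = (i, j)" by force
    have "g (i, j) < t" using g c by (auto simp: G_def PiE_def Pi_def ij)
    then have "F g c < Suc (i + j) * t" using c by (simp add: F_def ij)
    also have "\<dots> \<le> K * t" using assms(2)[of i j] c by (intro mult_le_mono1) (simp add: ij)
    finally show ?thesis .
  qed
  then have "F ` G \<subseteq> tableaux D (K * t)"
    using less by (auto simp: tableaux_def F_def less_imp_le)
  moreover have "inj_on F G"
  proof (rule inj_onI)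
    fix g g' assume g: "g \<in> G" "g' \<in> G" "F g = F g'"
    have "g c = g' c" if "c \<in> D" for c
      using fun_cong[OF g(3), of c] that by (auto simp: F_def split: prod.splits)
    then show "g = g'" using g by (intro PiE_ext[of g D "\<lambda>_. {..<t}" g']) (auto simp: G_def)
  qed
  ultimately have "card G \<le> card (tableaux D (K * t))"
    using card_image[of F G] card_mono[OF finite_tableaux[OF assms(1)]] by metis
  then show ?thesis by (simp add: G_def card_PiE assms(1))
qed

lemma tableau_sum_replicate_1:
  assumes "finite D"
  shows "tableau_sum D (replicate M 1) = of_nat (card (tableaux D M))"
proof -
  have "(\<Prod>c\<in>D. replicate M 1 ! T c) = (1 :: 'a)" if "T \<in> tableaux D M" for T
    using tableaux_less[OF that] by (intro prod.neutral) simp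
  then show ?thesis by (simp add: tableau_sum_def)
qed

lemma skew_schur_replicate_1:
  "skew_schur \<alpha> \<beta> (replicate M 1) = of_nat (card (tableaux (skew_diagram \<alpha> \<beta>) M))"
  unfolding skew_schur_eq_tableau_sum
  by (rule tableau_sum_replicate_1) (simp add: skew_diagram_eq_shape[OF order_refl])

text \<open>All parts are at least \<open>d\<close>, so there are at most \<open>m\<close> of them, with equality only if all equal \<open>d\<close>.\<close>

lemma size_parts_of_multiples:
  assumes "A \<in> parts_of (d * m)" "\<forall>k\<in>#A. d dvd k" "d > 0"
  shows "size A \<le> m" and "size A = m \<Longrightarrow> A = replicate_mset m d"
proof -
  have ge: "d \<le> k" if "k \<in># A" for k
    using that assms by (intro dvd_imp_le) (auto simp: parts_of_def intro: gr0I)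
  have bound: "d * size B \<le> \<Sum>\<^sub># B" if "\<forall>k\<in>#B. d \<le> k" for B
    using that by (induction B) auto
  have sum: "\<Sum>\<^sub># A = d * m" using assms(1) by (simp add: parts_of_def)
  then show "size A \<le> m" using bound[of A] ge assms(3) by simp
  assume size: "size A = m"
  have "k = d" if k: "k \<in># A" for k
  proof -
    obtain B where B: "A = add_mset k B" using multi_member_split[OF k] by blast
    have "d * size B \<le> \<Sum>\<^sub># B" using ge by (intro bound) (auto simp: B)
    then have "k \<le> d" using sum size by (auto simp: B)
    then show ?thesis using ge[OF k] by simp
  qed
  then show "A = replicate_mset m d" using size by (metis set_mset_subset_singletonD subsetI singletonI)
qed

text \<open>The sum is the power sum expansion at the \<open>d K t\<close> powers of a primitive \<open>d\<close>th root of unity, a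
polynomial in \<open>t\<close>. Divided by \<open>t\<^sup>m\<close>, it tends to a nonnegative multiple of the coefficient of the
partition \<open>(d\<^sup>m)\<close>. By assumption \<open>\<epsilon>\<close> times the quotient is at least \<open>1\<close> for positive \<open>t\<close>, so \<open>\<epsilon>\<close> times
the limit is positive.\<close>

lemma sgn_top_coefficient:
  fixes \<chi> :: "nat multiset \<Rightarrow> int" and \<epsilon> :: int
  assumes \<epsilon>: "\<epsilon> = 1 \<or> \<epsilon> = -1" and d: "d > 0"
    and lower: "\<And>t. real t ^ m \<le> of_int \<epsilon> * (\<Sum>A\<in>parts_of (d * m).
        of_int (\<chi> A) * (\<Prod>k\<in>#A. if d dvd k then real (d * (K * t)) else 0) / real (zmult A))"
  shows "sgn (\<chi> (replicate_mset m d)) = \<epsilon>"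
proof -
  define R where "R = replicate_mset m d"
  define w where "w A t = (\<Prod>k\<in>#A. if d dvd k then real (d * (K * t)) else 0)" for A t
  define l where "l A = (if A = R then real (d * K) ^ m else 0)" for A
  have "R \<in> parts_of (d * m)" using d by (auto simp: R_def parts_of_def sum_mset_replicate_mset mult.commute)
  have "(\<lambda>t. w A t / real t ^ m) \<longlonglongrightarrow> l A" if A: "A \<in> parts_of (d * m)" for A
  proof (cases "\<forall>k\<in>#A. d dvd k")
    case True
    have w: "w A t = real (d * K) ^ size A * real t ^ size A" for t
    proof -
      have "w A t = (\<Prod>k\<in>#A. real (d * (K * t)))"
        unfolding w_def using True by (intro arg_cong[where f = prod_mset] image_mset_cong) simp
      then show ?thesis by (simp add: prod_mset_constant power_mult_distrib mult_ac)
    qed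
    show ?thesis
    proof (cases "size A = m")
      case size: True
      then have "A = R" using size_parts_of_multiples(2)[OF A True d] by (simp add: R_def)
      then have "\<forall>\<^sub>F t in sequentially. w A t / real t ^ m = l A"
        unfolding w using size by (intro eventually_sequentiallyI[of 1]) (simp add: l_def)
      then show ?thesis by (rule tendsto_eventually)
    next
      case False
      then have size: "size A < m" using size_parts_of_multiples(1)[OF A True d] by simp
      have "A \<noteq> R" using False by (auto simp: R_def)
      have "(\<lambda>t. real (d * K) ^ size A * inverse (real t ^ (m - size A))) \<longlonglongrightarrow> real (d * K) ^ size A * 0"
        using size by (intro tendsto_mult tendsto_const tendsto_inverse_0_at_top
          filterlim_pow_at_top filterlim_real_sequentially) auto
      moreover have "\<forall>\<^sub>F t in sequentially. real (d * K) ^ size A * inverse (real t ^ (m - size A)) = w A t / real t ^ m"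
        unfolding w using size
        by (intro eventually_sequentiallyI[of 1]) (simp add: power_diff field_simps)
      ultimately show ?thesis using \<open>A \<noteq> R\<close> by (simp add: l_def filterlim_cong)
    qed
  next
    case False
    then obtain k where k: "k \<in># A" "\<not> d dvd k" by blast
    have "w A t = 0" for t
      using k by (auto simp: w_def prod_mset_zero_iff intro!: image_eqI[of _ _ k])
    moreover have "A \<noteq> R" using k by (auto simp: R_def split: if_splits)
    ultimately show ?thesis by (simp add: l_def)
  qed
  then have "(\<lambda>t. of_int \<epsilon> * (\<Sum>A\<in>parts_of (d * m). of_int (\<chi> A) * (w A t / real t ^ m) / real (zmult A)))
      \<longlonglongrightarrow> of_int \<epsilon> * (\<Sum>A\<in>parts_of (d * m). of_int (\<chi> A) * l A / real (zmult A))"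
    using zmult_pos by (intro tendsto_intros) (auto simp: parts_of_def)
  moreover have "\<forall>\<^sub>F t in sequentially.
      1 \<le> of_int \<epsilon> * (\<Sum>A\<in>parts_of (d * m). of_int (\<chi> A) * (w A t / real t ^ m) / real (zmult A))"
  proof (intro eventually_sequentiallyI[of 1])
    fix t :: nat assume "t \<ge> 1"
    then have pos: "real t ^ m > 0" by simp
    have "1 = real t ^ m / real t ^ m" using pos by simp
    also have "\<dots> \<le> (of_int \<epsilon> * (\<Sum>A\<in>parts_of (d * m). of_int (\<chi> A) * w A t / real (zmult A))) / real t ^ m"
      using lower[of t] unfolding w_def by (rule divide_right_mono) simp
    also have "\<dots> = of_int \<epsilon> * (\<Sum>A\<in>parts_of (d * m). of_int (\<chi> A) * (w A t / real t ^ m) / real (zmult A))"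
      by (simp add: sum_divide_distrib sum_distrib_left mult_ac)
    finally show "1 \<le> \<dots>" .
  qed
  ultimately have "1 \<le> of_int \<epsilon> * (\<Sum>A\<in>parts_of (d * m). of_int (\<chi> A) * l A / real (zmult A))"
    by (intro tendsto_lowerbound) auto
  also have "(\<Sum>A\<in>parts_of (d * m). of_int (\<chi> A) * l A / real (zmult A)) =
      (\<Sum>A\<in>{R}. of_int (\<chi> A) * real (d * K) ^ m / real (zmult A))"
    using \<open>R \<in> parts_of (d * m)\<close> finite_parts_of
    by (intro sum.mono_neutral_cong_right) (auto simp: l_def)
  finally have "0 < of_int (\<epsilon> * \<chi> R) * (real (d * K) ^ m / real (zmult R))" by simp
  moreover have "0 \<le> real (d * K) ^ m / real (zmult R)" by simp
  ultimately have "of_int (\<epsilon> * \<chi> R) > (0 :: real)" by (meson mult_nonpos_nonneg not_le)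
  then have "\<epsilon> * \<chi> R > 0" by (simp only: of_int_0_less_iff)
  then show ?thesis using \<epsilon> by (auto simp: R_def)
qed

lemma int_char_expansion_skew_schur:
  assumes "skew_partition lam mu"
  shows "int_char_expansion (skew_size lam mu) (skew_schur lam mu)"
proof -
  define r where "r = length lam"
  have p: "is_partition lam" "is_partition mu" "length mu \<le> r"
    using skew_partition_parts[OF assms] by (simp_all add: r_def)
  have "(\<Sum>i<r. part lam i) = (\<Sum>i<r. part mu i) + skew_size lam mu"
    using assms by (simp add: skew_size_def r_def[symmetric] sum.distrib[symmetric] skew_partition_def)
  then have "int_char_expansion (skew_size lam mu) (jacobi_trudi r (part lam) (part mu))"
    by (rule int_char_expansion_jacobi_trudi)
  then show ?thesis
    using skew_schur_jacobi_trudi[OF p(1,2) _ p(3), where ?'a = complex] assms by (simp add: r_def int_char_expansion_def)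
qed

theorem theorem5p4:
  fixes lam mu :: "nat list" and d N :: nat and \<omega> :: complex
  assumes "skew_partition lam mu"
    and "d > 0" and "N > 0" and "d dvd N"
    and "primitive_root_of_unity d \<omega>"
  shows "(\<not> d_quotient_exists d lam mu \<longrightarrow> skew_schur lam mu (map (\<lambda>k. \<omega> ^ k) [0..<N]) = 0) \<and>
    (d_quotient_exists d lam mu \<longrightarrow>
       (\<exists>m. skew_size lam mu = d * m \<and>
          skew_schur lam mu (map (\<lambda>k. \<omega> ^ k) [0..<N]) =
            of_int (sgn (skew_char lam mu (replicate m d))) *
            (\<Prod>(\<alpha>, \<beta>)\<leftarrow>d_quotient d lam mu. skew_schur \<alpha> \<beta> (replicate (N div d) 1))))"
proof -
  define M where "M = N div d"
  have N: "N = d * M" using assms(4) by (simp add: M_def)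
  define roots where "roots M = map (\<lambda>k. \<omega> ^ k) [0..<d * M]" for M
  define r where "r = length lam"
  define \<alpha> where "\<alpha> i = runner_partition d r lam i" for i
  define \<beta> where "\<beta> i = runner_partition d r mu i" for i
  define balanced where "balanced \<longleftrightarrow> (\<forall>i<d. card (runner_rows d r lam i) = card (runner_rows d r mu i))"
  have exists_iff: "d_quotient_exists d lam mu \<longleftrightarrow> balanced \<and> (\<forall>i<d. skew_partition (\<alpha> i) (\<beta> i))"
    unfolding d_quotient_exists_def balanced_def
    using d_core_eq_iff[OF skew_partition_parts(1,2)[OF assms(1)] order_refl skew_partition_parts(3)[OF assms(1)] assms(2)]
    by (auto simp: d_quotient_def \<alpha>_def \<beta>_def r_def)
  have quot: "(\<Prod>(\<alpha>, \<beta>)\<leftarrow>d_quotient d lam mu. f \<alpha> \<beta>) = (\<Prod>i<d. f (\<alpha> i) (\<beta> i))" for f :: "nat list \<Rightarrow> nat list \<Rightarrow> complex"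
    by (simp add: d_quotient_def o_def \<alpha>_def \<beta>_def r_def prod.distinct_set_conv_list[symmetric] atLeast0LessThan)
  show ?thesis
  proof (cases balanced)
    case False
    then obtain i where "i < d" "card (runner_rows d r lam i) \<noteq> card (runner_rows d r mu i)"
      by (auto simp: balanced_def)
    then have "skew_schur lam mu (map (\<lambda>k. \<omega> ^ k) [0..<N]) = 0"
      unfolding N r_def by (rule skew_schur_roots_unbalanced[OF assms(1) order_refl assms(2,5)])
    then show ?thesis using exists_iff False by simp
  next
    case True
    then have bal: "card (runner_rows d r lam i) = card (runner_rows d r mu i)" if "i < d" for i
      using that by (simp add: balanced_def)
    have r: "length lam \<le> r" by (simp add: r_def)
    obtain \<epsilon> :: int where \<epsilon>: "\<epsilon> = 1 \<or> \<epsilon> = -1" and schur_list: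
      "\<And>M. skew_schur lam mu (roots M) = of_int \<epsilon> *
        (\<Prod>i\<leftarrow>[0..<d]. if skew_partition (\<alpha> i) (\<beta> i) then skew_schur (\<alpha> i) (\<beta> i) (replicate M 1) else 0)"
      by (rule skew_schur_roots_balanced[OF assms(1) r assms(2,5) bal, folded roots_def \<alpha>_def \<beta>_def])
        (assumption, rule that)
    have schur: "skew_schur lam mu (roots M) = of_int \<epsilon> *
        (\<Prod>i<d. if skew_partition (\<alpha> i) (\<beta> i) then skew_schur (\<alpha> i) (\<beta> i) (replicate M 1) else 0)" for M
      unfolding schur_list by (simp add: prod.distinct_set_conv_list[symmetric] atLeast0LessThan)
    show ?thesis
    proof (cases "d_quotient_exists d lam mu")
      case False
      then obtain i where "i < d" "\<not> skew_partition (\<alpha> i) (\<beta> i)" using exists_iff True by blast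
      then have "(\<Prod>i<d. if skew_partition (\<alpha> i) (\<beta> i) then skew_schur (\<alpha> i) (\<beta> i) (replicate M 1) else 0) = (0 :: complex)"
        by (intro prod_zero) auto
      then show ?thesis using False schur[of M] by (simp add: roots_def N)
    next
      case ex: True
      then have sp: "skew_partition (\<alpha> i) (\<beta> i)" if "i < d" for i using exists_iff that by blast
      define m where "m = (\<Sum>i<d. skew_size (\<alpha> i) (\<beta> i))"
      have size: "skew_size lam mu = d * m"
        using skew_size_eq_quotient_sizes[OF assms(1) r assms(2) bal] sp by (simp add: m_def \<alpha>_def \<beta>_def)
      define C where "C M = (\<Prod>i<d. card (tableaux (skew_diagram (\<alpha> i) (\<beta> i)) M))" for M
      have schur': "skew_schur lam mu (roots M) = of_int \<epsilon> * of_nat (C M)" for M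
        unfolding schur C_def of_nat_prod by (simp add: sp skew_schur_replicate_1)
      define D where "D = (\<Union>i<d. skew_diagram (\<alpha> i) (\<beta> i))"
      have finD: "finite (skew_diagram (\<alpha> i) (\<beta> i))" for i
        by (simp add: skew_diagram_eq_shape[OF order_refl])
      then have "finite ((\<lambda>(i, j). i + j) ` D)" by (simp add: D_def)
      (* With K above all i + j, every cell of every quotient diagram fits into one of K blocks. *)
      then obtain K where K: "\<And>x. x \<in> (\<lambda>(i, j). i + j) ` D \<Longrightarrow> x < K"
        unfolding finite_nat_set_iff_bounded by blast
      have lower: "t ^ m \<le> C (K * t)" for t
      proof -
        have "t ^ m = (\<Prod>i<d. t ^ card (skew_diagram (\<alpha> i) (\<beta> i)))"
          by (simp add: m_def power_sum card_skew_diagram)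
        also have "\<dots> \<le> C (K * t)"
          unfolding C_def
        proof (intro prod_mono conjI)
          fix i assume "i \<in> {..<d}"
          then show "t ^ card (skew_diagram (\<alpha> i) (\<beta> i)) \<le> card (tableaux (skew_diagram (\<alpha> i) (\<beta> i)) (K * t))"
            using K by (intro card_tableaux_lower_bound finD) (force simp: D_def)
        qed simp
        finally show ?thesis .
      qed
      obtain \<chi> :: "nat multiset \<Rightarrow> int" where
        \<chi>: "\<And>xs :: complex list. skew_schur lam mu xs =
          (\<Sum>A\<in>parts_of (skew_size lam mu). of_int (\<chi> A) * pprod A xs / of_nat (zmult A))" and
        char: "\<And>\<nu>. \<nu> \<in> partitions_of (skew_size lam mu) \<Longrightarrow> skew_char lam mu \<nu> = \<chi> (mset \<nu>)"
        by (rule skew_char_expansion[OF int_char_expansion_skew_schur[OF assms(1)]]) (rule that)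
      (* The power sum expansion of the left side for K t blocks, as a real number. *)
      define S where "S t = (\<Sum>A\<in>parts_of (d * m).
        of_int (\<chi> A) * (\<Prod>k\<in>#A. if d dvd k then real (d * (K * t)) else 0) / real (zmult A))" for t
      have S: "complex_of_real (S t) = of_int \<epsilon> * of_nat (C (K * t))" for t
      proof -
        have "pprod A (roots (K * t)) = complex_of_real (\<Prod>k\<in>#A. if d dvd k then real (d * (K * t)) else 0)" for A
          unfolding pprod_def roots_def
          by (induction A) (simp_all add: psum_roots_of_unity[OF assms(5,2)])
        then have "complex_of_real (S t) = skew_schur lam mu (roots (K * t))"
          by (simp add: S_def \<chi> size)
        then show ?thesis by (simp only: schur')
      qed
      have "S t = of_int \<epsilon> * real (C (K * t))" for t
      proof -
        have "complex_of_real (S t) = complex_of_real (of_int \<epsilon> * real (C (K * t)))" by (simp add: S)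
        then show ?thesis by (simp only: of_real_eq_iff)
      qed
      then have "real t ^ m \<le> of_int \<epsilon> * S t" for t
      proof -
        have "real (t ^ m) \<le> real (C (K * t))" using lower by (simp only: of_nat_le_iff)
        moreover have "of_int \<epsilon> * S t = real (C (K * t))"
          unfolding \<open>\<And>t. S t = of_int \<epsilon> * real (C (K * t))\<close> using \<epsilon> by auto
        ultimately show ?thesis by simp
      qed
      then have sgn: "sgn (\<chi> (replicate_mset m d)) = \<epsilon>"
        unfolding S_def by (rule sgn_top_coefficient[OF \<epsilon> assms(2)])
      have "replicate m d \<in> partitions_of (skew_size lam mu)"
        using assms(2) by (auto simp: partitions_of_def is_partition_def size sum_list_replicate sorted_wrt_iff_nth_less)
      then have "sgn (skew_char lam mu (replicate m d)) = \<epsilon>" using char sgn by simp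
      moreover have "(\<Prod>i<d. if skew_partition (\<alpha> i) (\<beta> i) then skew_schur (\<alpha> i) (\<beta> i) (replicate M 1) else 0) =
          (\<Prod>(\<alpha>, \<beta>)\<leftarrow>d_quotient d lam mu. skew_schur \<alpha> \<beta> (replicate M (1 :: complex)))"
        unfolding quot by (rule prod.cong) (simp_all add: sp)
      ultimately have "skew_schur lam mu (map (\<lambda>k. \<omega> ^ k) [0..<N]) =
          of_int (sgn (skew_char lam mu (replicate m d))) *
          (\<Prod>(\<alpha>, \<beta>)\<leftarrow>d_quotient d lam mu. skew_schur \<alpha> \<beta> (replicate (N div d) 1))"
        using schur[of M] unfolding roots_def N[symmetric] M_def[symmetric] by (simp only:)
      then show ?thesis using ex size by blast
    qed
  qed
qed

end
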